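(* Let $p=1/3$ and let $\{X^t,y^t,\breve y^t,z^t\}$ be generated by OADMM-RR (defined in the context). Then $$\frac1T\sum_{t=1}^T \mathrm{Crit}(X^{t+1},\breve y^{t+1},z^{t+1})\le \mathcal O(T^{(p-1)/2})+\mathcal O(T^{-p})=\mathcal O(T^{-1/3}),$$ i.e. there is a constant $C$ independent of $T$ such that the left-hand side is at most $C\,T^{-1/3}$ for all integers $T\ge 1$. In other words, for $\epsilon>0$ there exists $\bar t\le T$ (with $\bar t\in\{1,\dots,T\}$) such that $\mathrm{Crit}(X^{\bar t+1},\breve y^{\bar t+1},z^{\bar t+1})\le\epsilon$, provided that $T\ge \mathcal O(1/\epsilon^3)$, i.e. $T\ge C'/\epsilon^3$ for a constant $C'$ independent of $\epsilon$ and $T$.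
   Context: Problem: $\mathcal M=\{X\in\mathbb R^{n\times r}: X^{\mathsf T}X=I_r\}$, $n\ge r$; minimize $F(X)=f(X)-g(X)+h(\mathcal A(X))$ over $X\in\mathcal M$, where $\mathcal A:\mathbb R^{n\times r}\to\mathbb R^m$ is linear with adjoint $\mathcal A^{\mathsf T}$ and $\overline{A}=\max_{V\neq0}\|\mathcal A(V)\|/\|V\|_F$. Standing assumptions: $f$ is differentiable with $\|\nabla f(X)-\nabla f(X')\|_F\le L_f\|X-X'\|_F$ for all $X,X'\in\mathbb R^{n\times r}$, and $\|\nabla f(X)\|_F\le C_f$ for $X\in\mathcal M$; $g$ is convex, proper and $C_g$-Lipschitz; $h$ is proper, lower semicontinuous, $C_h$-Lipschitz and $W_h$-weakly convex with $W_h\ge0$ (i.e. $h+\frac{W_h}{2}\|\cdot\|_2^2$ is convex); the proximal operator of $h$ can be computed exactly. Notation: $\partial$ is the (limiting) subdifferential; $\iota_{\mathcal M}$ is the indicator function of $\mathcal M$; for a set $S$, $\|S\|=\inf_{s\in S}\|s\|$. Moreau envelope: $h_\mu(y)=\min_{v} h(v)+\frac1{2\mu}\|v-y\|_2^2$. $S(X,y,z,\beta)=f(X)+\langle z,\mathcal A(X)-y\rangle+\frac\beta2\|\mathcal A(X)-y\|_2^2$; $L(X,y,z,\beta)=S(X,y,z,\beta)-g(X)+h_{\tau/\beta}(y)+\iota_{\mathcal M}(X)$. Retraction: $\mathrm{Retr}_X(\Delta)\in\mathcal M$ is a smooth map ($X\in\mathcal M$, $\Delta\in\mathbb R^{n\times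 r}$) with $\mathrm{Retr}_X(0)=X$ and $\lim_{T_X\mathcal M\ni\Delta\to0}\|\mathrm{Retr}_X(\Delta)-X-\Delta\|_F/\|\Delta\|_F=0$; there are constants $\dot k,\ddot k>0$ with $\|\mathrm{Retr}_X(\Delta)-X\|_F\le\dot k\|\Delta\|_F$ and $\|\mathrm{Retr}_X(\Delta)-X-\Delta\|_F\le\frac12\ddot k\|\Delta\|_F^2$ for $X\in\mathcal M$, $\Delta\in T_X\mathcal M$. Parameters: $p,\xi\in(0,1)$, $\sigma\in[1,2)$, $\tau\ge\frac{4}{2-\sigma}$, $\beta^0>0$ with $\beta^0\ge 2\tau W_h$, $\rho\in(0,\infty)$, $\gamma\in(0,1)$, $\delta\in(0,\frac1{\max(1,2\rho)})$, $\underline b,\overline b\in(0,\infty)$. OADMM-RR: start from $X^0\in\mathcal M$, $y^0,z^0\in\mathbb R^m$. For $t=0,1,2,\dots$: (S1) $\beta^t=\beta^0(1+\xi t^p)$, $\mu^t=\tau/\beta^t$. (S2) choose $G^t\in\nabla_XS(X^t,y^t,z^t,\beta^t)-\partial g(X^t)$; set $\mathbb G^t_\rho=G^t-\rho X^t[G^t]^{\mathsf T}X^t-(1-\rho)X^t[X^t]^{\mathsf T}G^t$; take $b^t\in(\underline b,\overline b)$; set $X^{t+1}=\mathrm{Retr}_{X^t}(-\eta^t\mathbb G^t_\rho)$, where $\eta^t=\frac{b^t\gamma^j}{\beta^t}$ and $j\in\{0,1,\dots\}$ is the smallest integer with $\dot L(\mathrm{Retr}_{X^t}(-\eta^t\mathbb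 G^t_\rho))-\dot L(X^t)\le-\delta\eta^t\|\mathbb G^t_\rho\|_F^2$, $\dot L(X)=L(X,y^t,z^t,\beta^t)$. (S3) $b=y^t-\frac1{\beta^t}\nabla_yS(X^{t+1},y^t,z^t,\beta^t)$; $y^{t+1}=\arg\min_y h_{\mu^t}(y)+\frac{\beta^t}2\|y-b\|_2^2$, equivalently $\breve y^{t+1}=\arg\min_{v}h(v)+\frac{1}{2(\mu^t+1/\beta^t)}\|v-b\|_2^2$ and $y^{t+1}=\frac{\breve y^{t+1}+\mu^t\beta^tb}{1+\mu^t\beta^t}$. (S4) $z^{t+1}=z^t+\sigma\beta^t(\mathcal A(X^{t+1})-y^{t+1})$. Stationarity measure: $\mathrm{Crit}(X,y,z)=\|\mathcal A(X)-y\|+\|\partial h(y)-z\|+\|\mathrm{Proj}_{T_X\mathcal M}(\nabla f(X)-\partial g(X)+\mathcal A^{\mathsf T}(z))\|_F$, where $\mathrm{Proj}_{T_X\mathcal M}(\Delta)=\Delta-\frac12X(\Delta^{\mathsf T}X+X^{\mathsf T}\Delta)$ for $X\in\mathcal M$. *)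

theory Defs
  imports "HOL-Analysis.Analysis"
begin

text \<open>
  An element of \<open>real ^ 'r ^ 'n\<close> is a real matrix with rows indexed by \<open>'n\<close> and columns
  indexed by \<open>'r\<close>; the library inner product and norm on this type are the trace inner
  product and the Frobenius norm.
\<close>

definition grad :: "('a::real_inner \<Rightarrow> real) \<Rightarrow> 'a \<Rightarrow> 'a" where
  "grad f x = (THE D. GDERIV f x :> D)"

definition frechet_subdiff :: "('a::euclidean_space \<Rightarrow> real) \<Rightarrow> 'a \<Rightarrow> 'a set" where
  "frechet_subdiff \<phi> x =
     {v. 0 \<le> Liminf (at x) (\<lambda>y. ereal ((\<phi> y - \<phi> x - v \<bullet> (y - x)) / norm (y - x)))}"

definition limiting_subdiff :: "('a::euclidean_space \<Rightarrow> real) \<Rightarrow> 'a \<Rightarrow> 'a set" where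
  "limiting_subdiff \<phi> x =
     {v. \<exists>u w. u \<longlonglongrightarrow> x \<and> (\<lambda>k. \<phi> (u k)) \<longlonglongrightarrow> \<phi> x \<and>
               (\<forall>k::nat. w k \<in> frechet_subdiff \<phi> (u k)) \<and> w \<longlonglongrightarrow> v}"

definition weakly_convex :: "real \<Rightarrow> ('a::real_normed_vector \<Rightarrow> real) \<Rightarrow> bool" where
  "weakly_convex W h \<longleftrightarrow> convex_on UNIV (\<lambda>y. h y + W / 2 * (norm y)\<^sup>2)"

text \<open>The infimum is over reals; on a Euclidean space it is attained whenever \<open>h\<close> is Lipschitz
  and \<open>\<mu> > 0\<close>.\<close>

definition moreau_env :: "('a::real_normed_vector \<Rightarrow> real) \<Rightarrow> real \<Rightarrow> 'a \<Rightarrow> real" where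
  "moreau_env h \<mu> y = (INF v. h v + 1 / (2 * \<mu>) * (norm (v - y))\<^sup>2)"

definition set_iota :: "'a set \<Rightarrow> 'a \<Rightarrow> ereal" where
  "set_iota S x = (if x \<in> S then 0 else \<infinity>)"

text \<open>A real infimum, hence only meaningful for nonempty sets; subdifferentials of
  real-valued (weakly) convex functions on a Euclidean space are never empty.\<close>

definition set_norm :: "'a::real_normed_vector set \<Rightarrow> real" where
  "set_norm S = (INF s\<in>S. norm s)"

definition stiefel :: "(real ^ 'r ^ 'n) set" where
  "stiefel = {X. transpose X ** X = mat 1}"

definition tangent :: "real ^ 'r ^ 'n \<Rightarrow> (real ^ 'r ^ 'n) set" where
  "tangent X = {\<Delta>. transpose \<Delta> ** X + transpose X ** \<Delta> = 0}"

definition proj_tangent :: "real ^ 'r ^ 'n \<Rightarrow> real ^ 'r ^ 'n \<Rightarrow> real ^ 'r ^ 'n" where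
  "proj_tangent X \<Delta> = \<Delta> - (1/2) *\<^sub>R (X ** (transpose \<Delta> ** X + transpose X ** \<Delta>))"

text \<open>\<open>k\<close> times continuously differentiable; intended for open \<open>U\<close> only.\<close>

primrec Ck_on :: "nat \<Rightarrow> 'a::euclidean_space set \<Rightarrow> ('a \<Rightarrow> 'b::euclidean_space) \<Rightarrow> bool" where
  "Ck_on 0 U F \<longleftrightarrow> continuous_on U F"
| "Ck_on (Suc k) U F \<longleftrightarrow>
     (\<forall>x\<in>U. F differentiable (at x)) \<and> (\<forall>v. Ck_on k U (\<lambda>x. frechet_derivative F (at x) v))"

text \<open>Smoothness on an arbitrary set: locally the restriction of a \<open>C\<^sup>\<infinity>\<close> map defined on an open
  set of the ambient space. On an embedded submanifold this is the usual notion.\<close>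

definition smooth_map_on :: "'a::euclidean_space set \<Rightarrow> ('a \<Rightarrow> 'b::euclidean_space) \<Rightarrow> bool" where
  "smooth_map_on D f \<longleftrightarrow>
     (\<forall>x\<in>D. \<exists>U F. open U \<and> x \<in> U \<and> (\<forall>k. Ck_on k U F) \<and> (\<forall>y\<in>U \<inter> D. F y = f y))"

definition retraction_with_consts ::
    "(real ^ 'r ^ 'n \<Rightarrow> real ^ 'r ^ 'n \<Rightarrow> real ^ 'r ^ 'n) \<Rightarrow> real \<Rightarrow> real \<Rightarrow> bool" where
  "retraction_with_consts Retr k1 k2 \<longleftrightarrow>
     (\<forall>X\<in>stiefel. \<forall>\<Delta>. Retr X \<Delta> \<in> stiefel) \<and>
     smooth_map_on (stiefel \<times> UNIV) (\<lambda>(X, \<Delta>). Retr X \<Delta>) \<and>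
     (\<forall>X\<in>stiefel. Retr X 0 = X) \<and>
     (\<forall>X\<in>stiefel. ((\<lambda>\<Delta>. norm (Retr X \<Delta> - X - \<Delta>) / norm \<Delta>) \<longlongrightarrow> 0) (at 0 within tangent X)) \<and>
     k1 > 0 \<and> k2 > 0 \<and>
     (\<forall>X\<in>stiefel. \<forall>\<Delta>\<in>tangent X.
        norm (Retr X \<Delta> - X) \<le> k1 * norm \<Delta> \<and>
        norm (Retr X \<Delta> - X - \<Delta>) \<le> 1/2 * k2 * (norm \<Delta>)\<^sup>2)"

definition S_fun ::
    "(real ^ 'r ^ 'n \<Rightarrow> real) \<Rightarrow> (real ^ 'r ^ 'n \<Rightarrow> real ^ 'm) \<Rightarrow>
     real ^ 'r ^ 'n \<Rightarrow> real ^ 'm \<Rightarrow> real ^ 'm \<Rightarrow> real \<Rightarrow> real" where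
  "S_fun f A X y z \<beta> = f X + z \<bullet> (A X - y) + \<beta> / 2 * (norm (A X - y))\<^sup>2"

definition L_fun ::
    "(real ^ 'r ^ 'n \<Rightarrow> real) \<Rightarrow> (real ^ 'r ^ 'n \<Rightarrow> real) \<Rightarrow> (real ^ 'm \<Rightarrow> real) \<Rightarrow>
     (real ^ 'r ^ 'n \<Rightarrow> real ^ 'm) \<Rightarrow> real \<Rightarrow>
     real ^ 'r ^ 'n \<Rightarrow> real ^ 'm \<Rightarrow> real ^ 'm \<Rightarrow> real \<Rightarrow> ereal" where
  "L_fun f g h A \<tau> X y z \<beta> =
     ereal (S_fun f A X y z \<beta> - g X + moreau_env h (\<tau> / \<beta>) y) + set_iota stiefel X"

definition Crit ::
    "(real ^ 'r ^ 'n \<Rightarrow> real) \<Rightarrow> (real ^ 'r ^ 'n \<Rightarrow> real) \<Rightarrow> (real ^ 'm \<Rightarrow> real) \<Rightarrow>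
     (real ^ 'r ^ 'n \<Rightarrow> real ^ 'm) \<Rightarrow> real ^ 'r ^ 'n \<Rightarrow> real ^ 'm \<Rightarrow> real ^ 'm \<Rightarrow> real" where
  "Crit f g h A X y z =
     norm (A X - y)
     + set_norm ((\<lambda>v. v - z) ` limiting_subdiff h y)
     + set_norm ((\<lambda>v. proj_tangent X (grad f X - v + adjoint A z)) ` limiting_subdiff g X)"

definition beta_seq :: "real \<Rightarrow> real \<Rightarrow> real \<Rightarrow> nat \<Rightarrow> real" where
  "beta_seq \<beta>0 \<xi> p t = \<beta>0 * (1 + \<xi> * real t powr p)"

definition G_rho :: "real \<Rightarrow> real ^ 'r ^ 'n \<Rightarrow> real ^ 'r ^ 'n \<Rightarrow> real ^ 'r ^ 'n" where
  "G_rho \<rho> X G = G - \<rho> *\<^sub>R (X ** transpose G ** X) - (1 - \<rho>) *\<^sub>R (X ** transpose X ** G)"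

text \<open>\<open>step\<close> is the trial step size and \<open>D\<close> the search direction (used with a minus sign).\<close>

definition armijo ::
    "(real ^ 'r ^ 'n \<Rightarrow> ereal) \<Rightarrow> (real ^ 'r ^ 'n \<Rightarrow> real ^ 'r ^ 'n \<Rightarrow> real ^ 'r ^ 'n) \<Rightarrow>
     real \<Rightarrow> real ^ 'r ^ 'n \<Rightarrow> real ^ 'r ^ 'n \<Rightarrow> real \<Rightarrow> bool" where
  "armijo Ldot Retr \<delta> X D step \<longleftrightarrow>
     Ldot (Retr X (- step *\<^sub>R D)) - Ldot X \<le> ereal (- \<delta> * step * (norm D)\<^sup>2)"

text \<open>
  \<open>oadmm_rr \<dots> X y yb z\<close>: the sequences \<open>X, y, yb, z\<close> form a run of the algorithm, with \<open>yb\<close> the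
  proximal points (breve y); \<open>yb 0\<close> is irrelevant. The free choices of the algorithm are the
  initial point, the subgradients entering \<open>G\<close>, and the initial step factors \<open>b\<close>; \<open>j t\<close> is
  the smallest exponent accepted by the line search.
\<close>

definition oadmm_rr ::
    "(real ^ 'r ^ 'n \<Rightarrow> real) \<Rightarrow> (real ^ 'r ^ 'n \<Rightarrow> real) \<Rightarrow> (real ^ 'm \<Rightarrow> real) \<Rightarrow>
     (real ^ 'r ^ 'n \<Rightarrow> real ^ 'm) \<Rightarrow> (real ^ 'r ^ 'n \<Rightarrow> real ^ 'r ^ 'n \<Rightarrow> real ^ 'r ^ 'n) \<Rightarrow>
     real \<Rightarrow> real \<Rightarrow> real \<Rightarrow> real \<Rightarrow> real \<Rightarrow> real \<Rightarrow> real \<Rightarrow> real \<Rightarrow> real \<Rightarrow> real \<Rightarrow>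
     (nat \<Rightarrow> real ^ 'r ^ 'n) \<Rightarrow> (nat \<Rightarrow> real ^ 'm) \<Rightarrow> (nat \<Rightarrow> real ^ 'm) \<Rightarrow> (nat \<Rightarrow> real ^ 'm) \<Rightarrow> bool"
where
  "oadmm_rr f g h A Retr p \<xi> \<sigma> \<tau> \<beta>0 \<rho> \<gamma> \<delta> b_lo b_hi X y yb z \<longleftrightarrow>
     X 0 \<in> stiefel \<and>
     (\<exists>(G :: nat \<Rightarrow> real ^ 'r ^ 'n) (b :: nat \<Rightarrow> real) (j :: nat \<Rightarrow> nat). \<forall>t.
        let \<beta> = beta_seq \<beta>0 \<xi> p t;
            \<mu> = \<tau> / \<beta>;
            Ldot = (\<lambda>U. L_fun f g h A \<tau> U (y t) (z t) \<beta>);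
            D = G_rho \<rho> (X t) (G t);
            step = (\<lambda>i. b t * \<gamma> ^ i / \<beta>);
            c = y t - (1 / \<beta>) *\<^sub>R grad (\<lambda>w. S_fun f A (X (Suc t)) w (z t) \<beta>) (y t)
        in
          (\<exists>v\<in>limiting_subdiff g (X t).
             G t = grad (\<lambda>U. S_fun f A U (y t) (z t) \<beta>) (X t) - v) \<and>
          b_lo < b t \<and> b t < b_hi \<and>
          armijo Ldot Retr \<delta> (X t) D (step (j t)) \<and>
          (\<forall>i < j t. \<not> armijo Ldot Retr \<delta> (X t) D (step i)) \<and>
          X (Suc t) = Retr (X t) (- step (j t) *\<^sub>R D) \<and>
          is_arg_min (\<lambda>w. moreau_env h \<mu> w + \<beta> / 2 * (norm (w - c))\<^sup>2) (\<lambda>_. True) (y (Suc t)) \<and>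
          is_arg_min (\<lambda>v. h v + 1 / (2 * (\<mu> + 1 / \<beta>)) * (norm (v - c))\<^sup>2) (\<lambda>_. True) (yb (Suc t)) \<and>
          z (Suc t) = z t + (\<sigma> * \<beta>) *\<^sub>R (A (X (Suc t)) - y (Suc t)))"

end

theory Submission
  imports Defs
begin

text \<open>
  Write \<open>dz t = z (t + 1) - z t\<close>, which is \<open>\<sigma> * \<beta> t\<close> times the residual \<open>A X - y\<close> at step
  \<open>t + 1\<close>, and \<open>D t\<close> for the search direction. The stationarity measure at step \<open>t + 1\<close> is
  at most a constant times \<open>1 / \<beta> t + norm (dz t) + norm (D (t + 1))\<close> (\<open>Crit_le\<close>), since the
  iterates come with explicit subgradients: \<open>env_grad t\<close>, the gradient of the Moreau envelope at
  \<open>y (t + 1)\<close>, is a subgradient of \<open>h\<close> at the prox point \<open>yb (t + 1)\<close>. The sum of \<open>1 / \<beta> t\<close>,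
  with \<open>\<beta> t\<close> of order \<open>t powr p\<close>, is of order \<open>T powr (1 - p)\<close>. What remains is the energy
  bound (\<open>energy_bound\<close>)
  that the sums of \<open>(norm (dz t))\<^sup>2 / \<beta> t\<close> and \<open>(norm (D t))\<^sup>2 / \<beta> t\<close> are bounded: it
  makes the sums of \<open>norm (dz t)\<close> and \<open>norm (D t)\<close> of order \<open>T powr ((1 + p) / 2)\<close> by the
  arithmetic-geometric mean inequality (\<open>sum_le_of_weighted_squares\<close>), and after division by \<open>T\<close>
  the exponents are \<open>- p\<close> and \<open>(p - 1) / 2\<close>. Both are \<open>- 1 / 3\<close> for \<open>p = 1 / 3\<close>.

  The energy bound rests on uniform bounds. Since \<open>h\<close> is Lipschitz, \<open>env_grad\<close> is bounded, and
  the multiplier update \<open>z (t + 1) = (1 - \<sigma>) *\<^sub>R z t + \<sigma> *\<^sub>R env_grad t\<close> is a contraction, so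
  the multipliers are bounded (\<open>norm_z\<close>). Hence the residuals are of order \<open>1 / \<beta>\<close> and the
  vectors \<open>G t\<close> are bounded. The objective of the line search has curvature of order \<open>\<beta> t\<close>, so
  it accepts every step below a constant multiple of \<open>1 / \<beta> t\<close>, and the backtracking
  therefore ends with a step of at least that order (\<open>step_lower_bound\<close>).

  One iteration then changes the augmented Lagrangian in four ways. The line search decreases it
  by a multiple of \<open>(norm (D t))\<^sup>2 / \<beta> t\<close>. The \<open>y\<close>-update decreases it by a multiple of
  \<open>\<beta> t * (norm (y t - y (t + 1)))\<^sup>2\<close>, because \<open>\<beta> t\<close> dominates the weak convexity of the
  envelope (\<open>envelope_step\<close>). The multiplier update increases it by
  \<open>(norm (dz t))\<^sup>2 / (\<sigma> * \<beta> t)\<close>, and the larger penalty by a multiple of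
  \<open>1 / \<beta> t - 1 / \<beta> (t + 1)\<close>, which telescopes. The multiplier term is the critical
  one: \<open>dz\<close> obeys a contraction driven by the differences of \<open>env_grad\<close>, and the envelope
  gradient is Lipschitz in \<open>y\<close> with constant \<open>\<beta> t / \<tau>\<close> (\<open>envelope_gradient_difference\<close>), so for
  \<open>\<tau> \<ge> 4 / (2 - \<sigma>)\<close> the increase is paid for by the \<open>y\<close>-update up to telescoping terms
  (\<open>dz_memory\<close>). Adding the telescoping terms to the Lagrangian gives a Lyapunov function that is
  bounded below.
\<close>

section \<open>Gradients\<close>

lemma grad_eqI:
  assumes "GDERIV f x :> D"
  shows "grad f x = D"
proof -
  have "D' = D" if "GDERIV f x :> D'" for D'
  proof -
    have "(\<lambda>h. h \<bullet> D') = (\<lambda>h. h \<bullet> D)"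
      using has_derivative_unique[of f "\<lambda>h. h \<bullet> D'" x "\<lambda>h. h \<bullet> D"] that assms
      by (simp add: gderiv_def)
    then have "(D' - D) \<bullet> D' = (D' - D) \<bullet> D"
      by metis
    then have "(D' - D) \<bullet> (D' - D) = 0"
      by (simp add: inner_diff_right)
    then show ?thesis
      by simp
  qed
  with assms show ?thesis
    unfolding grad_def by blast
qed

lemma differentiable_imp_GDERIV_grad:
  fixes f :: "'a::euclidean_space \<Rightarrow> real"
  assumes "f differentiable (at x)"
  shows "GDERIV f x :> grad f x"
proof -
  obtain f' where f': "(f has_derivative f') (at x)"
    using assms unfolding differentiable_def by blast
  then have lin: "linear f'"
    using has_derivative_linear by blast
  have "f' = (\<lambda>h. h \<bullet> adjoint f' 1)"
    using adjoint_works[OF lin, of _ 1] by auto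
  then have "GDERIV f x :> adjoint f' 1"
    using f' unfolding gderiv_def by simp
  then show ?thesis
    using grad_eqI by metis
qed

text \<open>The mean value theorem on the segment from \<open>x\<close> to \<open>y\<close>, together with the Lipschitz bound
  for the gradient, costs a factor 2 against the sharp constant \<open>L / 2\<close>; the line search only
  needs some finite constant.\<close>

lemma lipschitz_grad_upper_bound:
  fixes f :: "'a::euclidean_space \<Rightarrow> real"
  assumes diff: "\<And>u. f differentiable (at u)"
    and lip: "L-lipschitz_on UNIV (grad f)"
  shows "f y \<le> f x + grad f x \<bullet> (y - x) + L * (norm (y - x))\<^sup>2"
proof -
  define \<phi> where "\<phi> s = f (x + s *\<^sub>R (y - x))" for s :: real
  have der: "(\<phi> has_derivative (\<lambda>t. (t *\<^sub>R (y - x)) \<bullet> grad f (x + s *\<^sub>R (y - x)))) (at s)" for s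
  proof -
    have "((\<lambda>s. x + s *\<^sub>R (y - x)) has_derivative (\<lambda>t. t *\<^sub>R (y - x))) (at s)"
      by (auto intro!: derivative_eq_intros)
    moreover have "(f has_derivative (\<lambda>h. h \<bullet> grad f (x + s *\<^sub>R (y - x)))) (at (x + s *\<^sub>R (y - x)))"
      using differentiable_imp_GDERIV_grad[OF diff] by (simp add: gderiv_def)
    ultimately show ?thesis
      unfolding \<phi>_def by (rule has_derivative_compose)
  qed
  obtain s where s: "0 \<le> s" "s \<le> 1"
    "\<phi> 1 - \<phi> 0 = (y - x) \<bullet> grad f (x + s *\<^sub>R (y - x))"
    using mvt_very_simple[of 0 1 \<phi> "\<lambda>s t. (t *\<^sub>R (y - x)) \<bullet> grad f (x + s *\<^sub>R (y - x))"]
      der has_derivative_at_withinI by fastforce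
  have "dist (grad f (x + s *\<^sub>R (y - x))) (grad f x) \<le> L * dist (x + s *\<^sub>R (y - x)) x"
    using lipschitz_onD[OF lip] by blast
  also have "\<dots> = L * (s * norm (y - x))"
    using s by (simp add: dist_norm)
  also have "\<dots> \<le> L * (1 * norm (y - x))"
    using s lipschitz_on_nonneg[OF lip] by (intro mult_left_mono mult_right_mono) auto
  finally have *: "norm (grad f (x + s *\<^sub>R (y - x)) - grad f x) \<le> L * norm (y - x)"
    by (simp add: dist_norm)
  have "f y - f x - grad f x \<bullet> (y - x) = (grad f (x + s *\<^sub>R (y - x)) - grad f x) \<bullet> (y - x)"
    using s(3) by (simp add: \<phi>_def inner_diff_left[of _ _ "y - x"] inner_commute[of "y - x"])
  also have "\<dots> \<le> norm (grad f (x + s *\<^sub>R (y - x)) - grad f x) * norm (y - x)"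
    by (rule norm_cauchy_schwarz)
  also have "\<dots> \<le> L * norm (y - x) * norm (y - x)"
    using * by (rule mult_right_mono) simp
  finally show ?thesis
    by (simp add: power2_eq_square)
qed

section \<open>Subgradients\<close>

text \<open>A Frechet subgradient is only an asymptotic lower bound; along a ray it yields arbitrarily
  short steps on which the bound holds up to a prescribed relative error.\<close>

lemma frechet_subdiff_along_ray:
  fixes \<phi> :: "'a::euclidean_space \<Rightarrow> real"
  assumes v: "v \<in> frechet_subdiff \<phi> x" and d: "d \<noteq> 0" and e: "e > 0"
  obtains s where "0 < s" "s \<le> 1" "\<phi> (x + s *\<^sub>R d) - \<phi> x - s * (v \<bullet> d) > - e * s"
proof -
  have "ereal (- e / norm d) < 0"
    using e d by simp
  then have ev: "\<forall>\<^sub>F y in at x. ereal (- e / norm d) < ereal ((\<phi> y - \<phi> x - v \<bullet> (y - x)) / norm (y - x))"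
    using v unfolding frechet_subdiff_def le_Liminf_iff by blast
  have "filterlim (\<lambda>s. x + s *\<^sub>R d) (at x) (at_right (0::real))"
    unfolding filterlim_at
  proof
    show "\<forall>\<^sub>F s in at_right 0. x + s *\<^sub>R d \<in> UNIV \<and> x + s *\<^sub>R d \<noteq> x"
      using d by (auto simp: eventually_at_filter)
    have "((\<lambda>s. x + s *\<^sub>R d) \<longlongrightarrow> x + 0 *\<^sub>R d) (at_right (0::real))"
      by (intro tendsto_intros)
    then show "((\<lambda>s. x + s *\<^sub>R d) \<longlongrightarrow> x) (at_right (0::real))"
      by simp
  qed
  from eventually_compose_filterlim[OF ev this]
  have "\<forall>\<^sub>F s in at_right (0::real).
      - e / norm d < (\<phi> (x + s *\<^sub>R d) - \<phi> x - v \<bullet> (x + s *\<^sub>R d - x)) / norm (x + s *\<^sub>R d - x)"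
    by (simp only: less_ereal.simps)
  moreover have "\<forall>\<^sub>F s in at_right (0::real). 0 < s \<and> s < 1"
    using eventually_at_right_real[of 0 1] by simp
  ultimately have "\<forall>\<^sub>F s in at_right (0::real). (0 < s \<and> s < 1) \<and>
      - e / norm d < (\<phi> (x + s *\<^sub>R d) - \<phi> x - v \<bullet> (x + s *\<^sub>R d - x)) / norm (x + s *\<^sub>R d - x)"
    by (rule eventually_conj[rotated])
  from eventually_happens'[OF trivial_limit_at_right_real this]
  obtain s where s: "0 < s" "s < 1"
    "- e / norm d < (\<phi> (x + s *\<^sub>R d) - \<phi> x - v \<bullet> (x + s *\<^sub>R d - x)) / norm (x + s *\<^sub>R d - x)"
    by blast
  have "- e / norm d < (\<phi> (x + s *\<^sub>R d) - \<phi> x - s * (v \<bullet> d)) / (s * norm d)"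
    using s by simp
  then have "- e / norm d * (s * norm d) < \<phi> (x + s *\<^sub>R d) - \<phi> x - s * (v \<bullet> d)"
    using d s by (simp add: pos_less_divide_eq)
  then have "\<phi> (x + s *\<^sub>R d) - \<phi> x - s * (v \<bullet> d) > - e * s"
    using d by simp
  then show thesis
    using that[of s] s by simp
qed

lemma frechet_subdiff_norm_le:
  fixes \<phi> :: "'a::euclidean_space \<Rightarrow> real"
  assumes v: "v \<in> frechet_subdiff \<phi> x" and lip: "C-lipschitz_on UNIV \<phi>"
  shows "norm v \<le> C"
proof (rule ccontr)
  assume "\<not> norm v \<le> C"
  then have less: "C < norm v"
    by simp
  then have v0: "v \<noteq> 0"
    using lipschitz_on_nonneg[OF lip] by auto
  then have "(norm v - C) * norm v > 0"
    using less by simp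
  from frechet_subdiff_along_ray[OF v v0 this] obtain s where s: "0 < s" "s \<le> 1"
    "\<phi> (x + s *\<^sub>R v) - \<phi> x - s * (v \<bullet> v) > - ((norm v - C) * norm v) * s" by blast
  have "\<phi> (x + s *\<^sub>R v) - \<phi> x \<le> C * (s * norm v)"
    using lipschitz_onD[OF lip, of "x + s *\<^sub>R v" x] s by (simp add: dist_norm)
  moreover have "v \<bullet> v = norm v * norm v"
    by (simp add: dot_square_norm power2_eq_square)
  ultimately show False
    using s by (simp add: algebra_simps)
qed

lemma convex_on_affine: "convex_on UNIV (\<lambda>w. a \<bullet> w + b)" for b :: real
  by (intro convex_onI) (simp_all add: inner_add_right algebra_simps)

text \<open>After adding \<open>W / 2 * (norm (y - x))\<^sup>2\<close> the error of the linearization is convex in \<open>y\<close> and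
  vanishes at \<open>x\<close>; a negative value anywhere would force a negative slope at \<open>x\<close>.\<close>

lemma weakly_convex_frechet_subgradient:
  fixes h :: "'a::euclidean_space \<Rightarrow> real"
  assumes wc: "weakly_convex W h" and W: "W \<ge> 0" and v: "v \<in> frechet_subdiff h x"
  shows "h y \<ge> h x + v \<bullet> (y - x) - W / 2 * (norm (y - x))\<^sup>2"
proof (rule ccontr)
  define d where "d = y - x"
  define F where "F w = h w - h x - v \<bullet> (w - x) + W / 2 * (norm (w - x))\<^sup>2" for w
  assume "\<not> ?thesis"
  then have neg: "F y < 0"
    by (simp add: F_def)
  have "F w = (h w + W / 2 * (norm w)\<^sup>2) +
      ((- v - W *\<^sub>R x) \<bullet> w + (v \<bullet> x - h x + W / 2 * (norm x)\<^sup>2))" for w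
    by (simp add: F_def power2_norm_eq_inner algebra_simps inner_commute)
  then have "F = (\<lambda>w. (h w + W / 2 * (norm w)\<^sup>2) +
      ((- v - W *\<^sub>R x) \<bullet> w + (v \<bullet> x - h x + W / 2 * (norm x)\<^sup>2)))"
    by auto
  moreover have "convex_on UNIV (\<lambda>w. (- v - W *\<^sub>R x) \<bullet> w + (v \<bullet> x - h x + W / 2 * (norm x)\<^sup>2))"
    by (rule convex_on_affine)
  ultimately have conv: "convex_on UNIV F"
    using wc unfolding weakly_convex_def by (auto intro: convex_on_add)
  have d0: "d \<noteq> 0"
    using neg by (auto simp: d_def F_def)
  obtain s where s: "0 < s" "s \<le> 1" "h (x + s *\<^sub>R d) - h x - s * (v \<bullet> d) > - (- F y) * s"
    using frechet_subdiff_along_ray[OF v d0, of "- F y"] neg by auto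
  have "F (x + s *\<^sub>R d) \<le> s * F y"
  proof -
    have "x + s *\<^sub>R d = (1 - s) *\<^sub>R x + s *\<^sub>R y"
      by (simp add: d_def algebra_simps)
    then have "F (x + s *\<^sub>R d) \<le> (1 - s) * F x + s * F y"
      using convex_onD[OF conv, of s x y] s by simp
    then show ?thesis
      by (simp add: F_def)
  qed
  moreover have "F (x + s *\<^sub>R d) \<ge> h (x + s *\<^sub>R d) - h x - s * (v \<bullet> d)"
    using W by (simp add: F_def)
  ultimately show False
    using s by (simp add: mult.commute)
qed

lemma convex_limiting_subgradient:
  fixes g :: "'a::euclidean_space \<Rightarrow> real"
  assumes conv: "convex_on UNIV g" and v: "v \<in> limiting_subdiff g x"
  shows "g y \<ge> g x + v \<bullet> (y - x)"
proof -
  obtain u w where uw: "u \<longlonglongrightarrow> x" "(\<lambda>k. g (u k)) \<longlonglongrightarrow> g x"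
    "\<And>k::nat. w k \<in> frechet_subdiff g (u k)" "w \<longlonglongrightarrow> v"
    using v unfolding limiting_subdiff_def by blast
  have "g y \<ge> g (u k) + w k \<bullet> (y - u k)" for k
    using weakly_convex_frechet_subgradient[OF _ _ uw(3), of 0 k y] conv
    by (simp add: weakly_convex_def)
  moreover have "(\<lambda>k. g (u k) + w k \<bullet> (y - u k)) \<longlonglongrightarrow> g x + v \<bullet> (y - x)"
    using uw by (intro tendsto_intros)
  ultimately show ?thesis
    by (intro LIMSEQ_le_const2[of _ "g x + v \<bullet> (y - x)"]) auto
qed

lemma limiting_subdiff_norm_le:
  fixes \<phi> :: "'a::euclidean_space \<Rightarrow> real"
  assumes v: "v \<in> limiting_subdiff \<phi> x" and lip: "C-lipschitz_on UNIV \<phi>"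
  shows "norm v \<le> C"
proof -
  obtain u w where uw: "\<And>k::nat. w k \<in> frechet_subdiff \<phi> (u k)" "w \<longlonglongrightarrow> v"
    using v unfolding limiting_subdiff_def by blast
  then show ?thesis
    using LIMSEQ_le_const2[OF tendsto_norm[OF uw(2)], of C] frechet_subdiff_norm_le[OF _ lip]
    by blast
qed

lemma frechet_subdiff_subset_limiting_subdiff: "frechet_subdiff \<phi> x \<subseteq> limiting_subdiff \<phi> x"
proof
  fix v assume "v \<in> frechet_subdiff \<phi> x"
  then show "v \<in> limiting_subdiff \<phi> x"
    unfolding limiting_subdiff_def
    by (intro CollectI exI[of _ "\<lambda>_. x"] exI[of _ "\<lambda>_. v"]) simp
qed

lemma quadratic_minorant_imp_frechet_subdiff:
  fixes \<phi> :: "'a::euclidean_space \<Rightarrow> real"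
  assumes "\<And>y. \<phi> y \<ge> \<phi> x + v \<bullet> (y - x) - q * (norm (y - x))\<^sup>2"
  shows "v \<in> frechet_subdiff \<phi> x"
proof -
  have "0 = Liminf (at x) (\<lambda>y. ereal (- q * norm (y - x)))"
  proof -
    have "((\<lambda>y. - q * norm (y - x)) \<longlongrightarrow> - q * norm (x - x)) (at x)"
      by (intro tendsto_intros)
    then have "((\<lambda>y. ereal (- q * norm (y - x))) \<longlongrightarrow> 0) (at x)"
      by (simp add: zero_ereal_def)
    then show ?thesis
      by (intro lim_imp_Liminf[symmetric]) auto
  qed
  also have "\<dots> \<le> Liminf (at x) (\<lambda>y. ereal ((\<phi> y - \<phi> x - v \<bullet> (y - x)) / norm (y - x)))"
  proof (rule Liminf_mono, rule eventually_at_filter[THEN iffD2], rule always_eventually, intro allI impI)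
    fix y assume "y \<noteq> x"
    then have "- q * norm (y - x) = (- q * (norm (y - x))\<^sup>2) / norm (y - x)"
      by (simp add: power2_eq_square)
    also have "\<dots> \<le> (\<phi> y - \<phi> x - v \<bullet> (y - x)) / norm (y - x)"
      using assms[of y] by (intro divide_right_mono) auto
    finally show "ereal (- q * norm (y - x)) \<le> ereal ((\<phi> y - \<phi> x - v \<bullet> (y - x)) / norm (y - x))"
      by simp
  qed
  finally show ?thesis
    unfolding frechet_subdiff_def by simp
qed

text \<open>Fermat's rule for a proximal subproblem.\<close>

lemma prox_point_frechet_subdiff:
  fixes h :: "'a::euclidean_space \<Rightarrow> real"
  assumes "is_arg_min (\<lambda>v. h v + q * (norm (v - c))\<^sup>2) (\<lambda>_. True) x"
  shows "(2 * q) *\<^sub>R (c - x) \<in> frechet_subdiff h x"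
proof (rule quadratic_minorant_imp_frechet_subdiff)
  fix y
  have "h x + q * (norm (x - c))\<^sup>2 \<le> h y + q * (norm (y - c))\<^sup>2"
    using assms by (auto simp: is_arg_min_def not_less)
  moreover have "(norm (y - c))\<^sup>2 = (norm (x - c))\<^sup>2 - 2 * ((c - x) \<bullet> (y - x)) + (norm (y - x))\<^sup>2"
    by (simp add: power2_norm_eq_inner algebra_simps inner_commute)
  ultimately show "h y \<ge> h x + (2 * q) *\<^sub>R (c - x) \<bullet> (y - x) - q * (norm (y - x))\<^sup>2"
    by (simp add: algebra_simps)
qed

lemma set_norm_le: "s \<in> S \<Longrightarrow> set_norm S \<le> norm s"
  unfolding set_norm_def by (rule cINF_lower) (auto intro: bdd_belowI[of _ 0])

section \<open>The Moreau envelope and the proximal step\<close>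

lemma lipschitz_prox_lower_bound:
  fixes h :: "'a::real_normed_vector \<Rightarrow> real"
  assumes lip: "C-lipschitz_on UNIV h" and \<mu>: "\<mu> > 0"
  shows "h y - C\<^sup>2 * \<mu> / 2 \<le> h v + 1 / (2 * \<mu>) * (norm (v - y))\<^sup>2"
proof -
  have "h y - h v \<le> C * norm (v - y)"
    using lipschitz_onD[OF lip, of v y] by (simp add: dist_norm)
  moreover have "0 \<le> (norm (v - y) - \<mu> * C)\<^sup>2 / (2 * \<mu>)"
    using \<mu> by simp
  moreover have "(norm (v - y) - \<mu> * C)\<^sup>2 / (2 * \<mu>)
      = 1 / (2 * \<mu>) * (norm (v - y))\<^sup>2 - C * norm (v - y) + C\<^sup>2 * \<mu> / 2"
    using \<mu> by (simp add: power2_eq_square field_simps)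
  ultimately show ?thesis
    by linarith
qed

lemma moreau_env_lower_bound:
  fixes h :: "'a::real_normed_vector \<Rightarrow> real"
  assumes "C-lipschitz_on UNIV h" and "\<mu> > 0"
  shows "h y - C\<^sup>2 * \<mu> / 2 \<le> moreau_env h \<mu> y"
  unfolding moreau_env_def
  by (rule cINF_greatest) (use lipschitz_prox_lower_bound[OF assms] in auto)

lemma moreau_env_le:
  fixes h :: "'a::real_normed_vector \<Rightarrow> real"
  assumes "C-lipschitz_on UNIV h" and "\<mu> > 0"
  shows "moreau_env h \<mu> y \<le> h v + 1 / (2 * \<mu>) * (norm (v - y))\<^sup>2"
  unfolding moreau_env_def
  by (rule cINF_lower, rule bdd_belowI2[OF lipschitz_prox_lower_bound[OF assms]]) simp

lemma prox_growth:
  fixes h :: "'a::euclidean_space \<Rightarrow> real"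
  assumes wc: "weakly_convex W h" "W \<ge> 0"
    and x: "is_arg_min (\<lambda>v. h v + q * (norm (v - c))\<^sup>2) (\<lambda>_. True) x"
  shows "h v + q * (norm (v - c))\<^sup>2 \<ge> h x + q * (norm (x - c))\<^sup>2 + (q - W / 2) * (norm (v - x))\<^sup>2"
proof -
  have "h v \<ge> h x + (2 * q) *\<^sub>R (c - x) \<bullet> (v - x) - W / 2 * (norm (v - x))\<^sup>2"
    using weakly_convex_frechet_subgradient[OF wc prox_point_frechet_subdiff[OF x]] .
  moreover have "(norm (v - c))\<^sup>2 = (norm (x - c))\<^sup>2 - 2 * ((c - x) \<bullet> (v - x)) + (norm (v - x))\<^sup>2"
    by (simp add: power2_norm_eq_inner algebra_simps inner_commute)
  then have "q * (norm (v - c))\<^sup>2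
      = q * (norm (x - c))\<^sup>2 - 2 * q * ((c - x) \<bullet> (v - x)) + q * (norm (v - x))\<^sup>2"
    by (simp add: distrib_left right_diff_distrib)
  ultimately show ?thesis
    by (simp only: inner_scaleR_left left_diff_distrib)
qed

text \<open>Completing the square in \<open>w\<close>: the two quadratic penalties of the joint problem in
  \<open>(v, w)\<close> combine into one penalty on \<open>v\<close> alone and the deviation of \<open>w\<close> from its optimal
  value for that \<open>v\<close>. The penalty parameter of the envelope is \<open>\<tau> / \<beta>\<close>.\<close>

lemma two_penalties_complete_square:
  fixes v w c :: "'a::real_inner"
  assumes "\<tau> > 0" "\<beta> > 0"
  shows "1 / (2 * (\<tau> / \<beta>)) * (norm (v - w))\<^sup>2 + \<beta> / 2 * (norm (w - c))\<^sup>2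
    = \<beta> / (2 * (1 + \<tau>)) * (norm (v - c))\<^sup>2
      + \<beta> * (1 + \<tau>) / (2 * \<tau>) * (norm (w - (1 / (1 + \<tau>)) *\<^sub>R (v + \<tau> *\<^sub>R c)))\<^sup>2"
proof -
  define a where "a = v - c"
  define b where "b = w - c"
  have 1: "v - w = a - b" "w - c = b" "v - c = a"
    by (simp_all add: a_def b_def)
  have "(1 / (1 + \<tau>)) *\<^sub>R (v + \<tau> *\<^sub>R c) = c + (1 / (1 + \<tau>)) *\<^sub>R a"
  proof -
    have "v + \<tau> *\<^sub>R c = (1 + \<tau>) *\<^sub>R c + a"
      by (simp add: a_def algebra_simps)
    then show ?thesis
      using assms by (simp add: scaleR_add_right)
  qed
  then have 2: "w - (1 / (1 + \<tau>)) *\<^sub>R (v + \<tau> *\<^sub>R c) = b - (1 / (1 + \<tau>)) *\<^sub>R a"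
    by (simp add: b_def)
  define s where "s = 1 + \<tau>"
  have s: "s > 0" "s \<noteq> 0" "\<tau> = s - 1"
    using assms by (auto simp: s_def)
  have 3: "(norm (a - b))\<^sup>2 = a \<bullet> a - 2 * (a \<bullet> b) + b \<bullet> b"
    "(norm (b - (1 / s) *\<^sub>R a))\<^sup>2 = b \<bullet> b - 2 * (1 / s) * (a \<bullet> b) + (1 / s)\<^sup>2 * (a \<bullet> a)"
    "(norm a)\<^sup>2 = a \<bullet> a" "(norm b)\<^sup>2 = b \<bullet> b"
    unfolding power2_norm_eq_inner
    by (simp_all add: inner_diff_left inner_diff_right inner_commute[of b a] power2_eq_square right_diff_distrib
        del: times_divide_eq_left times_divide_eq_right)
  have "\<beta> / (2 * \<tau>) * (aa - 2 * ab + bb) + \<beta> / 2 * bb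
    = \<beta> / (2 * s) * aa + \<beta> * s / (2 * \<tau>) * (bb - 2 * (1 / s) * ab + (1 / s)\<^sup>2 * aa)" for aa ab bb :: real
  proof -
    have "\<beta> / (2 * s) * aa + \<beta> * s / (2 * \<tau>) * ((1 / s)\<^sup>2 * aa) = \<beta> / (2 * \<tau>) * aa"
      using s assms(1) unfolding s(3) by (simp add: field_simps power2_eq_square)
    moreover have "\<beta> * s / (2 * \<tau>) * bb = \<beta> / (2 * \<tau>) * bb + \<beta> / 2 * bb"
      using s assms(1) unfolding s_def by (simp add: field_simps)
    moreover have "\<beta> * s / (2 * \<tau>) * (2 * (1 / s) * ab) = \<beta> / (2 * \<tau>) * (2 * ab)"
      using s by simp
    ultimately show ?thesis
      by (simp only: distrib_left right_diff_distrib)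
  qed
  from this[of "a \<bullet> a" "a \<bullet> b" "b \<bullet> b"] show ?thesis
    unfolding 1 s_def[symmetric] 2[folded s_def] 3 by (simp add: mult.commute)
qed

text \<open>Equality holds for \<open>d = r + s\<close> and \<open>M * s = k * r\<close>.\<close>

lemma weighted_sum_squares_ge:
  fixes k M r s d :: real
  assumes "k > 0" "M > 0" "d \<le> r + s" "d \<ge> 0"
  shows "M * s\<^sup>2 + k * r\<^sup>2 \<ge> M * k / (M + k) * d\<^sup>2"
proof -
  have "(M + k) * (M * s\<^sup>2 + k * r\<^sup>2) = M * k * (r + s)\<^sup>2 + (M * s - k * r)\<^sup>2"
    by (simp add: power2_eq_square algebra_simps)
  also have "\<dots> \<ge> M * k * d\<^sup>2"
    using assms by (auto intro!: mult_left_mono power_mono add_increasing2)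
  finally show ?thesis
    using assms by (simp add: field_simps)
qed

text \<open>Minimize jointly over the prox variable \<open>v\<close> and over \<open>w\<close>. Completing the square reduces
  the problem to the prox problem for \<open>v\<close>, whose objective grows quadratically away from
  \<open>yb\<close> because \<open>h\<close> is only mildly nonconvex at the scale \<open>\<beta>\<close>; the penalty on \<open>w\<close> transfers this
  growth to the envelope problem. The modulus \<open>\<beta> * (1 - 1 / \<tau>)\<close> is the difference between
  the strong convexity \<open>\<beta>\<close> of the penalty and the weak convexity \<open>\<beta> / \<tau>\<close> of the envelope.\<close>

lemma envelope_step_growth:
  fixes h :: "'a::euclidean_space \<Rightarrow> real"
  assumes lip: "C-lipschitz_on UNIV h" and wc: "weakly_convex W h" "W \<ge> 0"
    and \<beta>: "\<beta> > 0" "2 * \<tau> * W \<le> \<beta>" and \<tau>: "\<tau> > 1"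
    and yb: "is_arg_min (\<lambda>v. h v + 1 / (2 * (\<tau> / \<beta> + 1 / \<beta>)) * (norm (v - c))\<^sup>2) (\<lambda>_. True) yb"
  defines "y' \<equiv> (1 / (1 + \<tau>)) *\<^sub>R (yb + \<tau> *\<^sub>R c)"
  shows "moreau_env h (\<tau> / \<beta>) w + \<beta> / 2 * (norm (w - c))\<^sup>2
    \<ge> h yb + 1 / (2 * (\<tau> / \<beta>)) * (norm (yb - y'))\<^sup>2 + \<beta> / 2 * (norm (y' - c))\<^sup>2
      + \<beta> / 2 * (1 - 1 / \<tau>) * (norm (w - y'))\<^sup>2"
proof -
  have t0: "\<tau> > 0"
    using \<tau> by simp
  define q where "q = \<beta> / (2 * (1 + \<tau>))"
  have q: "1 / (2 * (\<tau> / \<beta> + 1 / \<beta>)) = q"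
    using \<beta> \<tau> by (simp add: q_def add_divide_distrib[symmetric] add.commute)
  define Q where "Q = h yb + 1 / (2 * (\<tau> / \<beta>)) * (norm (yb - y'))\<^sup>2 + \<beta> / 2 * (norm (y' - c))\<^sup>2"
  have Q: "Q = h yb + q * (norm (yb - c))\<^sup>2"
    using two_penalties_complete_square[OF t0 \<beta>(1), of yb y' c]
    unfolding Q_def q_def by (simp add: y'_def)
  \<comment> \<open>\<open>M\<close> bounds the growth of the prox objective, measured by the displacement of the optimal \<open>w\<close>
    (a fraction \<open>1 / (1 + \<tau>)\<close> of the displacement of \<open>v\<close>); \<open>k\<close> is the weight on the
    deviation of \<open>w\<close> from that optimum.\<close>
  define M where "M = \<beta> * (1 + \<tau>) * (\<tau> - 1) / (4 * \<tau>)"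
  define k where "k = \<beta> * (1 + \<tau>) / (2 * \<tau>)"
  have Mk: "M > 0" "k > 0"
    using \<beta> \<tau> by (auto simp: M_def k_def)
  have "M * k / (M + k) = \<beta> / 2 * (1 - 1 / \<tau>)"
  proof -
    have M: "M = k * ((\<tau> - 1) / 2)"
      by (simp add: M_def k_def)
    have Mk': "k * ((\<tau> - 1) / 2) + k = k * ((\<tau> + 1) / 2)"
      by (simp add: algebra_simps add_divide_distrib diff_divide_distrib)
    have "M * k / (M + k) = k * ((\<tau> - 1) / (\<tau> + 1))"
      unfolding M Mk' using Mk \<tau> by simp
    also have "\<dots> = \<beta> / 2 * (1 - 1 / \<tau>)"
      using \<tau> by (simp add: k_def divide_simps)
    finally show ?thesis .
  qed
  note mod = this
  \<comment> \<open>A bound uniform in \<open>v\<close>; the infimum over \<open>v\<close> turns its right side into the envelope at \<open>w\<close>.\<close>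
  have main: "Q + \<beta> / 2 * (1 - 1 / \<tau>) * (norm (w - y'))\<^sup>2 - \<beta> / 2 * (norm (w - c))\<^sup>2
      \<le> h v + 1 / (2 * (\<tau> / \<beta>)) * (norm (v - w))\<^sup>2" for v
  proof -
    define yv where "yv = (1 / (1 + \<tau>)) *\<^sub>R (v + \<tau> *\<^sub>R c)"
    have grow: "h v + q * (norm (v - c))\<^sup>2 \<ge> Q + (q - W / 2) * (norm (v - yb))\<^sup>2"
      unfolding Q using prox_growth[OF wc yb[unfolded q]] .
    have "yv - y' = (1 / (1 + \<tau>)) *\<^sub>R (v - yb)"
      by (simp add: yv_def y'_def algebra_simps)
    then have "norm (yv - y') = norm (v - yb) / (1 + \<tau>)"
      using \<tau> by simp
    then have nv: "norm (v - yb) = (1 + \<tau>) * norm (yv - y')"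
      using \<tau> by simp
    have "W \<le> \<beta> / (2 * \<tau>)"
      using \<beta> \<tau> by (simp add: field_simps)
    then have "(q - \<beta> / (2 * \<tau>) / 2) * (1 + \<tau>)\<^sup>2 \<le> (q - W / 2) * (1 + \<tau>)\<^sup>2"
      by (intro mult_right_mono) auto
    also have "(q - \<beta> / (2 * \<tau>) / 2) * (1 + \<tau>)\<^sup>2 = M"
      using \<tau> by (simp add: q_def M_def divide_simps power2_eq_square) (simp add: algebra_simps)
    finally have "M * (norm (yv - y'))\<^sup>2 \<le> (q - W / 2) * (1 + \<tau>)\<^sup>2 * (norm (yv - y'))\<^sup>2"
      by (intro mult_right_mono) auto
    also have "\<dots> = (q - W / 2) * (norm (v - yb))\<^sup>2"
      by (simp add: nv power_mult_distrib)
    finally have "h v + q * (norm (v - c))\<^sup>2 \<ge> Q + M * (norm (yv - y'))\<^sup>2"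
      using grow by linarith
    moreover have "1 / (2 * (\<tau> / \<beta>)) * (norm (v - w))\<^sup>2 + \<beta> / 2 * (norm (w - c))\<^sup>2
        = q * (norm (v - c))\<^sup>2 + k * (norm (w - yv))\<^sup>2"
      unfolding q_def k_def yv_def using two_penalties_complete_square[OF t0 \<beta>(1)] .
    moreover have "norm (w - y') \<le> norm (w - yv) + norm (yv - y')"
      using norm_triangle_ineq[of "w - yv" "yv - y'"] by simp
    then have "M * (norm (yv - y'))\<^sup>2 + k * (norm (w - yv))\<^sup>2 \<ge> \<beta> / 2 * (1 - 1 / \<tau>) * (norm (w - y'))\<^sup>2"
      using weighted_sum_squares_ge[OF Mk(2,1)] unfolding mod by simp
    ultimately show ?thesis
      by linarith
  qed
  have "Q + \<beta> / 2 * (1 - 1 / \<tau>) * (norm (w - y'))\<^sup>2 - \<beta> / 2 * (norm (w - c))\<^sup>2 \<le> moreau_env h (\<tau> / \<beta>) w"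
    unfolding moreau_env_def[of h "\<tau> / \<beta>" w] by (rule cINF_greatest) (use main in auto)
  then show ?thesis
    unfolding Q_def by linarith
qed

text \<open>By \<open>envelope_step_growth\<close> the only minimizer of the envelope problem is the convex
  combination of prox point and center. Multiplying the displacement from the center by \<open>\<beta>\<close>
  gives the vector \<open>u\<close> that is at the same time the gradient of the envelope at \<open>y\<close> and a
  subgradient of \<open>h\<close> at \<open>yb\<close>.\<close>

lemma envelope_step:
  fixes h :: "'a::euclidean_space \<Rightarrow> real"
  assumes lip: "C-lipschitz_on UNIV h" and wc: "weakly_convex W h" "W \<ge> 0"
    and \<beta>: "\<beta> > 0" "2 * \<tau> * W \<le> \<beta>" and \<tau>: "\<tau> > 1"
    and yb: "is_arg_min (\<lambda>v. h v + 1 / (2 * (\<tau> / \<beta> + 1 / \<beta>)) * (norm (v - c))\<^sup>2) (\<lambda>_. True) yb"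
    and y: "is_arg_min (\<lambda>w. moreau_env h (\<tau> / \<beta>) w + \<beta> / 2 * (norm (w - c))\<^sup>2) (\<lambda>_. True) y"
  defines "u \<equiv> \<beta> *\<^sub>R (c - y)"
  shows "y = yb + (\<tau> / \<beta>) *\<^sub>R u"
    and "u \<in> frechet_subdiff h yb"
    and "moreau_env h (\<tau> / \<beta>) y = h yb + \<tau> / (2 * \<beta>) * (norm u)\<^sup>2"
    and "moreau_env h (\<tau> / \<beta>) w + \<beta> / 2 * (norm (w - c))\<^sup>2
      \<ge> moreau_env h (\<tau> / \<beta>) y + \<beta> / 2 * (norm (y - c))\<^sup>2 + \<beta> / 2 * (1 - 1 / \<tau>) * (norm (w - y))\<^sup>2"
proof -
  define y' where "y' = (1 / (1 + \<tau>)) *\<^sub>R (yb + \<tau> *\<^sub>R c)"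
  have \<mu>: "\<tau> / \<beta> > 0"
    using \<tau> \<beta> by simp
  note growth = envelope_step_growth[OF lip wc \<beta> \<tau> yb, folded y'_def]
  have le: "moreau_env h (\<tau> / \<beta>) y' \<le> h yb + 1 / (2 * (\<tau> / \<beta>)) * (norm (yb - y'))\<^sup>2"
    by (rule moreau_env_le[OF lip \<mu>])
  have y_le: "moreau_env h (\<tau> / \<beta>) y + \<beta> / 2 * (norm (y - c))\<^sup>2
      \<le> moreau_env h (\<tau> / \<beta>) y' + \<beta> / 2 * (norm (y' - c))\<^sup>2"
    using y by (auto simp: is_arg_min_def not_less)
  have "\<beta> / 2 * (1 - 1 / \<tau>) * (norm (y - y'))\<^sup>2 \<le> 0"
    using growth[of y] le y_le by linarith
  moreover have "\<beta> / 2 * (1 - 1 / \<tau>) > 0"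
    using \<beta> \<tau> by simp
  ultimately have "(norm (y - y'))\<^sup>2 \<le> 0"
    by (metis mult_le_0_iff not_less)
  then have y_eq: "y = y'"
    by simp
  have y'2: "(1 + \<tau>) *\<^sub>R y' = yb + \<tau> *\<^sub>R c"
    using \<tau> by (simp add: y'_def)
  have \<mu>u: "(\<tau> / \<beta>) *\<^sub>R u = \<tau> *\<^sub>R (c - y)"
    using \<beta> by (simp add: u_def)
  have "yb = (1 + \<tau>) *\<^sub>R y - \<tau> *\<^sub>R c"
    using y'2 by (simp add: y_eq)
  then show y_yb: "y = yb + (\<tau> / \<beta>) *\<^sub>R u"
    unfolding \<mu>u by (simp add: algebra_simps)
  have "c - yb = (1 + \<tau>) *\<^sub>R (c - y)"
    using y'2 unfolding y_eq by (simp add: algebra_simps)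
  moreover have "2 * (1 / (2 * (\<tau> / \<beta> + 1 / \<beta>))) = \<beta> / (1 + \<tau>)"
    using \<beta> \<tau> by (simp add: field_simps)
  ultimately have "(2 * (1 / (2 * (\<tau> / \<beta> + 1 / \<beta>)))) *\<^sub>R (c - yb) = u"
    using \<tau> by (simp add: u_def)
  then show "u \<in> frechet_subdiff h yb"
    using prox_point_frechet_subdiff[OF yb] by simp
  have env: "moreau_env h (\<tau> / \<beta>) y = h yb + 1 / (2 * (\<tau> / \<beta>)) * (norm (yb - y))\<^sup>2"
    using growth[of y'] le unfolding y_eq by simp
  have "norm (yb - y) = \<tau> / \<beta> * norm u"
    using \<beta> \<tau> by (simp add: y_yb)
  then show "moreau_env h (\<tau> / \<beta>) y = h yb + \<tau> / (2 * \<beta>) * (norm u)\<^sup>2"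
    unfolding env \<open>norm (yb - y) = \<tau> / \<beta> * norm u\<close> using \<tau> \<beta> by (simp add: power2_eq_square)
  show "moreau_env h (\<tau> / \<beta>) w + \<beta> / 2 * (norm (w - c))\<^sup>2
      \<ge> moreau_env h (\<tau> / \<beta>) y + \<beta> / 2 * (norm (y - c))\<^sup>2 + \<beta> / 2 * (1 - 1 / \<tau>) * (norm (w - y))\<^sup>2"
    using growth[of w] env unfolding y_eq by simp
qed

text \<open>With \<open>yb\<^sub>i = y\<^sub>i - \<mu>\<^sub>i *\<^sub>R u\<^sub>i\<close> the vectors \<open>u\<^sub>i\<close> are the gradients of the Moreau envelopes at
  \<open>y\<^sub>i\<close>. Hypomonotonicity of the subgradients of \<open>h\<close> makes each gradient Lipschitz with
  constant \<open>1 / \<mu>\<close> as long as \<open>2 * W * \<mu> \<le> 1\<close>; the second term accounts for the change of \<open>\<mu>\<close>.\<close>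

lemma envelope_gradient_difference:
  fixes h :: "'a::euclidean_space \<Rightarrow> real"
  assumes lip: "C-lipschitz_on UNIV h" and wc: "weakly_convex W h" "W \<ge> 0"
    and u: "u1 \<in> frechet_subdiff h yb1" "u2 \<in> frechet_subdiff h yb2"
    and y: "y1 = yb1 + \<mu>1 *\<^sub>R u1" "y2 = yb2 + \<mu>2 *\<^sub>R u2"
    and \<mu>: "\<mu>1 > 0" "2 * W * \<mu>1 \<le> 1"
  shows "\<mu>1 * norm (u1 - u2) \<le> norm (y1 - y2) + \<bar>\<mu>1 - \<mu>2\<bar> * C"
proof -
  define e where "e = yb1 - yb2"
  define d where "d = e + \<mu>1 *\<^sub>R (u1 - u2)"
  have 1: "h yb1 \<ge> h yb2 + u2 \<bullet> (yb1 - yb2) - W / 2 * (norm (yb1 - yb2))\<^sup>2"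
    by (rule weakly_convex_frechet_subgradient[OF wc u(2)])
  have 2: "h yb2 \<ge> h yb1 + u1 \<bullet> (yb2 - yb1) - W / 2 * (norm (yb2 - yb1))\<^sup>2"
    by (rule weakly_convex_frechet_subgradient[OF wc u(1)])
  have "(u1 - u2) \<bullet> e = - (u1 \<bullet> (yb2 - yb1)) - u2 \<bullet> (yb1 - yb2)"
    by (simp add: e_def algebra_simps)
  then have mono: "(u1 - u2) \<bullet> e \<ge> - W * (norm e)\<^sup>2"
    using 1 2 by (simp add: e_def norm_minus_commute)
  have "(norm d)\<^sup>2 = (norm e)\<^sup>2 + 2 * \<mu>1 * ((u1 - u2) \<bullet> e) + \<mu>1\<^sup>2 * (norm (u1 - u2))\<^sup>2"
    unfolding d_def power2_norm_eq_inner
    by (simp add: inner_add_left inner_add_right inner_commute[of e "u1 - u2"] power2_eq_square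
        distrib_left)
  moreover have "2 * \<mu>1 * ((u1 - u2) \<bullet> e) \<ge> 2 * \<mu>1 * (- W * (norm e)\<^sup>2)"
    using mono \<mu> by (intro mult_left_mono) auto
  moreover have "(2 * W * \<mu>1) * (norm e)\<^sup>2 \<le> 1 * (norm e)\<^sup>2"
    using \<mu>(2) by (rule mult_right_mono) simp
  ultimately have "(\<mu>1 * norm (u1 - u2))\<^sup>2 \<le> (norm d)\<^sup>2"
    by (simp add: power_mult_distrib algebra_simps)
  then have "\<mu>1 * norm (u1 - u2) \<le> norm d"
    using abs_le_square_iff[of "\<mu>1 * norm (u1 - u2)" "norm d"] \<mu> by simp
  also have "d = (y1 - y2) - (\<mu>1 - \<mu>2) *\<^sub>R u2"
    by (simp add: d_def e_def y algebra_simps)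
  also have "norm \<dots> \<le> norm (y1 - y2) + \<bar>\<mu>1 - \<mu>2\<bar> * norm u2"
    using norm_triangle_ineq4 by (metis norm_scaleR)
  also have "\<dots> \<le> norm (y1 - y2) + \<bar>\<mu>1 - \<mu>2\<bar> * C"
    using frechet_subdiff_norm_le[OF u(2) lip] by (simp add: mult_left_mono)
  finally show ?thesis .
qed

section \<open>Search directions on the Stiefel manifold\<close>

lemma inner_matrix_eq_sum: "A \<bullet> B = (\<Sum>i\<in>UNIV. \<Sum>j\<in>UNIV. A $ i $ j * B $ i $ j)"
  for A B :: "real ^ 'r ^ 'n"
  by (simp add: inner_vec_def)

lemma inner_transpose: "transpose A \<bullet> transpose B = A \<bullet> B"
  for A B :: "real ^ 'r ^ 'n"
  unfolding inner_matrix_eq_sum by (subst sum.swap) (simp add: transpose_def)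

lemma inner_matrix_mult_left: "(A ** B) \<bullet> C = B \<bullet> (transpose A ** C)"
  for A :: "real ^ 'k ^ 'n" and B :: "real ^ 'r ^ 'k" and C :: "real ^ 'r ^ 'n"
proof -
  have "(A ** B) \<bullet> C = (\<Sum>i\<in>UNIV. \<Sum>j\<in>UNIV. \<Sum>k\<in>UNIV. A $ i $ k * B $ k $ j * C $ i $ j)"
    by (simp add: inner_matrix_eq_sum matrix_matrix_mult_def sum_distrib_right)
  also have "\<dots> = (\<Sum>i\<in>UNIV. \<Sum>k\<in>UNIV. \<Sum>j\<in>UNIV. A $ i $ k * B $ k $ j * C $ i $ j)"
    by (rule sum.cong[OF refl], rule sum.swap)
  also have "\<dots> = (\<Sum>k\<in>UNIV. \<Sum>i\<in>UNIV. \<Sum>j\<in>UNIV. A $ i $ k * B $ k $ j * C $ i $ j)"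
    by (rule sum.swap)
  also have "\<dots> = (\<Sum>k\<in>UNIV. \<Sum>j\<in>UNIV. \<Sum>i\<in>UNIV. A $ i $ k * B $ k $ j * C $ i $ j)"
    by (rule sum.cong[OF refl], rule sum.swap)
  also have "\<dots> = B \<bullet> (transpose A ** C)"
    by (simp add: inner_matrix_eq_sum matrix_matrix_mult_def transpose_def sum_distrib_left mult_ac)
  finally show ?thesis .
qed

lemma matrix_mult_diff_right: "A ** (B - C) = A ** B - A ** C"
  for A :: "real ^ 'k ^ 'n" and B C :: "real ^ 'r ^ 'k"
  by (simp add: vec_eq_iff matrix_matrix_mult_def sum_subtractf right_diff_distrib)

lemma matrix_mult_diff_left: "(A - B) ** C = A ** C - B ** C"
  for A B :: "real ^ 'k ^ 'n" and C :: "real ^ 'r ^ 'k"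
  by (simp add: vec_eq_iff matrix_matrix_mult_def sum_subtractf left_diff_distrib)

lemma transpose_diff: "transpose (A - B) = transpose A - transpose B"
  for A B :: "real ^ 'r ^ 'n"
  by (simp add: vec_eq_iff transpose_def)

lemma stiefel_norm_sq:
  fixes X :: "real ^ 'r ^ 'n"
  assumes "X \<in> stiefel"
  shows "(norm X)\<^sup>2 = (norm (mat 1 :: real ^ 'r ^ 'r))\<^sup>2"
proof -
  have XX: "transpose X ** X = mat 1"
    using assms by (simp add: stiefel_def)
  have "(norm X)\<^sup>2 = (X ** mat 1) \<bullet> X"
    by (simp add: power2_norm_eq_inner)
  also have "\<dots> = (norm (mat 1 :: real ^ 'r ^ 'r))\<^sup>2"
    unfolding inner_matrix_mult_left XX by (simp add: power2_norm_eq_inner)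
  finally show ?thesis .
qed

text \<open>The part of \<open>G\<close> orthogonal to the range of \<open>X\<close>, and twice the skew part of
  \<open>transpose X ** G\<close>. Every search direction \<open>G_rho \<rho> X G\<close>, and the tangential projection,
  which is the case \<open>\<rho> = 1 / 2\<close>, combines these two orthogonal components.\<close>

definition normal_part :: "real ^ 'r ^ 'n \<Rightarrow> real ^ 'r ^ 'n \<Rightarrow> real ^ 'r ^ 'n" where
  "normal_part X G = G - X ** (transpose X ** G)"

definition skew_part :: "real ^ 'r ^ 'n \<Rightarrow> real ^ 'r ^ 'n \<Rightarrow> real ^ 'r ^ 'r" where
  "skew_part X G = transpose X ** G - transpose G ** X"

lemma G_rho_decomp: "G_rho \<rho> X G = normal_part X G + \<rho> *\<^sub>R (X ** skew_part X G)"
  by (simp add: G_rho_def normal_part_def skew_part_def matrix_mult_diff_right matrix_mul_assoc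
      algebra_simps)

lemma proj_tangent_eq_G_rho: "proj_tangent X G = G_rho (1 / 2) X G"
  by (simp add: G_rho_def proj_tangent_def matrix_add_ldistrib matrix_mul_assoc algebra_simps)

context
  fixes X :: "real ^ 'r ^ 'n"
  assumes X: "X \<in> stiefel"
begin

lemma transpose_mult_self: "transpose X ** X = mat 1"
  using X by (simp add: stiefel_def)

lemma transpose_mult_normal_part: "transpose X ** normal_part X G = 0"
  by (simp add: normal_part_def matrix_mult_diff_right matrix_mul_assoc transpose_mult_self)

lemma inner_normal_part: "normal_part X G \<bullet> (X ** B) = 0"
  using inner_matrix_mult_left[of X B "normal_part X G"]
  by (simp add: transpose_mult_normal_part inner_commute)

lemma inner_mult_stiefel: "(X ** B) \<bullet> (X ** C) = B \<bullet> C"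
  by (simp add: inner_matrix_mult_left matrix_mul_assoc transpose_mult_self)

lemma norm_G_rho: "(norm (G_rho \<rho> X G))\<^sup>2 = (norm (normal_part X G))\<^sup>2 + \<rho>\<^sup>2 * (norm (skew_part X G))\<^sup>2"
  unfolding G_rho_decomp power2_norm_eq_inner
  by (simp add: inner_add_left inner_add_right inner_normal_part inner_mult_stiefel
      inner_commute[of "X ** skew_part X G" "normal_part X G"] power2_eq_square)

lemma inner_G_rho: "G \<bullet> G_rho \<rho> X G = (norm (normal_part X G))\<^sup>2 + \<rho> / 2 * (norm (skew_part X G))\<^sup>2"
proof -
  define M where "M = transpose X ** G"
  have tM: "transpose M = transpose G ** X"
    by (simp add: M_def matrix_transpose_mul)
  have K: "skew_part X G = M - transpose M"
    unfolding skew_part_def tM by (simp only: M_def)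
  have "G \<bullet> normal_part X G = (norm (normal_part X G))\<^sup>2"
  proof -
    have "G = normal_part X G + X ** (transpose X ** G)"
      by (simp add: normal_part_def)
    then have "G \<bullet> normal_part X G = (normal_part X G + X ** (transpose X ** G)) \<bullet> normal_part X G"
      by simp
    also have "\<dots> = (norm (normal_part X G))\<^sup>2"
      using inner_normal_part[of G "transpose X ** G"]
      by (simp add: inner_add_left inner_add_right inner_commute power2_norm_eq_inner)
    finally show ?thesis .
  qed
  moreover have "G \<bullet> (X ** skew_part X G) = (norm (skew_part X G))\<^sup>2 / 2"
  proof -
    have "G \<bullet> (X ** skew_part X G) = M \<bullet> (M - transpose M)"
      using inner_matrix_mult_left[of X "skew_part X G" G] by (simp add: inner_commute M_def K)
    also have "\<dots> = (M \<bullet> (M - transpose M) + transpose M \<bullet> transpose (M - transpose M)) / 2"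
      by (simp add: inner_transpose)
    also have "\<dots> = (M - transpose M) \<bullet> (M - transpose M) / 2"
      by (simp add: transpose_diff inner_diff_left inner_diff_right)
    finally show ?thesis
      by (simp add: K power2_norm_eq_inner)
  qed
  ultimately show ?thesis
    by (simp add: G_rho_decomp inner_add_right)
qed

text \<open>The two sides weigh the normal and the skew component differently: by \<open>1\<close> and \<open>\<rho>\<^sup>2\<close> on the
  left, by \<open>1\<close> and \<open>\<rho> / 2\<close> in the inner product. The larger of the two ratios 1 and \<open>2 * \<rho>\<close> is
  where the bound on the line search parameter \<open>\<delta>\<close> comes from.\<close>

lemma inner_G_rho_ge:
  assumes "\<rho> > 0"
  shows "(norm (G_rho \<rho> X G))\<^sup>2 \<le> max 1 (2 * \<rho>) * (G \<bullet> G_rho \<rho> X G)"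
proof -
  have "1 * (norm (normal_part X G))\<^sup>2 \<le> max 1 (2 * \<rho>) * (norm (normal_part X G))\<^sup>2"
    by (rule mult_right_mono) auto
  moreover have "(2 * \<rho>) * (\<rho> / 2 * (norm (skew_part X G))\<^sup>2)
      \<le> max 1 (2 * \<rho>) * (\<rho> / 2 * (norm (skew_part X G))\<^sup>2)"
    using assms by (intro mult_right_mono) auto
  ultimately show ?thesis
    unfolding norm_G_rho inner_G_rho by (simp add: power2_eq_square distrib_left)
qed

lemma norm_proj_tangent_le_G_rho:
  assumes "\<rho> > 0"
  shows "norm (proj_tangent X G) \<le> max 1 (1 / (2 * \<rho>)) * norm (G_rho \<rho> X G)"
proof -
  define m where "m = max 1 (1 / (2 * \<rho>))"
  have "1 / (2 * \<rho>) * \<rho> \<le> m * \<rho>"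
    using assms by (intro mult_right_mono) (auto simp: m_def)
  then have m: "m \<ge> 1" "m * \<rho> \<ge> 1 / 2"
    using assms by (simp_all add: m_def)
  have "1\<^sup>2 \<le> m\<^sup>2"
    using m(1) by (rule power_mono) simp
  moreover have "(1 / 2)\<^sup>2 \<le> (m * \<rho>)\<^sup>2"
    using m(2) by (rule power_mono) simp
  ultimately have "1\<^sup>2 * (norm (normal_part X G))\<^sup>2 + (1 / 2)\<^sup>2 * (norm (skew_part X G))\<^sup>2
      \<le> m\<^sup>2 * (norm (normal_part X G))\<^sup>2 + (m * \<rho>)\<^sup>2 * (norm (skew_part X G))\<^sup>2"
    by (meson add_mono mult_right_mono zero_le_power2)
  then have "(norm (proj_tangent X G))\<^sup>2 \<le> (m * norm (G_rho \<rho> X G))\<^sup>2"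
    by (simp only: proj_tangent_eq_G_rho power_mult_distrib norm_G_rho distrib_left mult.assoc
        power_one mult_1_left)
  moreover have "0 \<le> m * norm (G_rho \<rho> X G)"
    using m(1) by simp
  ultimately show ?thesis
    unfolding m_def by (rule power2_le_imp_le)
qed

text \<open>An orthogonal projection satisfies \<open>(norm (P G))\<^sup>2 = G \<bullet> P G\<close>.\<close>

lemma norm_proj_tangent_le: "norm (proj_tangent X G) \<le> norm G"
proof -
  have "(norm (proj_tangent X G))\<^sup>2 = G \<bullet> proj_tangent X G"
    unfolding proj_tangent_eq_G_rho norm_G_rho inner_G_rho by (simp add: power2_eq_square)
  also have "\<dots> \<le> norm G * norm (proj_tangent X G)"
    by (rule norm_cauchy_schwarz)
  finally show ?thesis
    by (cases "norm (proj_tangent X G) = 0") (auto simp: power2_eq_square)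
qed

text \<open>\<open>transpose X ** G_rho \<rho> X G\<close> is \<open>\<rho>\<close> times the skew part.\<close>

lemma scaleR_G_rho_tangent: "s *\<^sub>R G_rho \<rho> X G \<in> tangent X"
proof -
  have tK: "transpose (skew_part X G) = - skew_part X G"
    by (simp add: skew_part_def transpose_diff matrix_transpose_mul)
  have XD: "transpose X ** G_rho \<rho> X G = \<rho> *\<^sub>R skew_part X G"
    by (simp add: G_rho_decomp matrix_add_ldistrib transpose_mult_normal_part
        matrix_scalar_ac scalar_matrix_assoc[symmetric] matrix_mul_assoc transpose_mult_self)
  have "transpose (G_rho \<rho> X G) ** X = transpose (transpose X ** G_rho \<rho> X G)"
    by (simp add: matrix_transpose_mul)
  also have "\<dots> = - (\<rho> *\<^sub>R skew_part X G)"
    by (simp add: XD transpose_scalar tK)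
  finally have DX: "transpose (G_rho \<rho> X G) ** X = - (\<rho> *\<^sub>R skew_part X G)" .
  have "transpose (s *\<^sub>R G_rho \<rho> X G) ** X + transpose X ** (s *\<^sub>R G_rho \<rho> X G) =
      s *\<^sub>R (transpose (G_rho \<rho> X G) ** X + transpose X ** G_rho \<rho> X G)"
    by (simp add: transpose_scalar matrix_scalar_ac scalar_matrix_assoc[symmetric] scaleR_add_right)
  then show ?thesis
    by (simp add: tangent_def XD DX)
qed

end

lemma proj_tangent_diff: "proj_tangent X (G - H) = proj_tangent X G - proj_tangent X H"
  unfolding proj_tangent_def
  by (simp add: transpose_diff matrix_mult_diff_right matrix_add_ldistrib matrix_mult_diff_left
      algebra_simps)

section \<open>The penalty sequence and averaging\<close>

lemma beta_seq_ge:
  assumes "\<beta>0 > 0" "0 < \<xi>"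
  shows "beta_seq \<beta>0 \<xi> p t \<ge> \<beta>0"
  using assms by (simp add: beta_seq_def)

lemma beta_seq_mono:
  assumes "\<beta>0 > 0" "0 < \<xi>" "0 < p"
  shows "beta_seq \<beta>0 \<xi> p t \<le> beta_seq \<beta>0 \<xi> p (Suc t)"
proof -
  have "real t powr p \<le> real (Suc t) powr p"
    using assms by (intro powr_mono2) auto
  then show ?thesis
    using assms by (simp add: beta_seq_def)
qed

lemma beta_seq_Suc_le:
  assumes "\<beta>0 > 0" "0 < \<xi>" "\<xi> < 1" "0 < p" "p < 1"
  shows "beta_seq \<beta>0 \<xi> p (Suc t) \<le> 2 * beta_seq \<beta>0 \<xi> p t"
proof (cases "t = 0")
  case True
  then show ?thesis
    using assms by (simp add: beta_seq_def)
next
  case False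
  then have "real (Suc t) powr p \<le> (2 * real t) powr p"
    using assms by (intro powr_mono2) auto
  also have "\<dots> = 2 powr p * real t powr p"
    by (simp add: powr_mult)
  also have "\<dots> \<le> 2 powr 1 * real t powr p"
    using assms by (intro mult_right_mono powr_mono) auto
  finally have "\<xi> * real (Suc t) powr p \<le> \<xi> * (2 * real t powr p)"
    using assms by (intro mult_left_mono) auto
  then have "1 + \<xi> * real (Suc t) powr p \<le> 2 * (1 + \<xi> * real t powr p)"
    by (simp add: distrib_left)
  then have "\<beta>0 * (1 + \<xi> * real (Suc t) powr p) \<le> \<beta>0 * (2 * (1 + \<xi> * real t powr p))"
    using assms by (intro mult_left_mono) (simp_all only:)
  then show ?thesis
    by (simp add: beta_seq_def mult_ac)
qed

lemma beta_seq_lower: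
  assumes "\<beta>0 > 0" "0 < \<xi>"
  shows "beta_seq \<beta>0 \<xi> p t \<ge> \<beta>0 * \<xi> * real t powr p"
  using assms by (simp add: beta_seq_def distrib_left)

lemma beta_seq_upper:
  assumes "\<beta>0 > 0" "0 < \<xi>" "\<xi> < 1" "0 < p" "t \<le> T" "1 \<le> T"
  shows "beta_seq \<beta>0 \<xi> p t \<le> 2 * \<beta>0 * real T powr p"
proof -
  have "real t powr p \<le> real T powr p"
    using assms by (intro powr_mono2) auto
  moreover have "1 \<le> real T powr p"
    using assms by (intro ge_one_powr_ge_zero) auto
  moreover have "\<xi> * real t powr p \<le> 1 * real t powr p"
    using assms by (intro mult_right_mono) auto
  ultimately have "1 + \<xi> * real t powr p \<le> 2 * real T powr p"
    by linarith
  then have "\<beta>0 * (1 + \<xi> * real t powr p) \<le> \<beta>0 * (2 * real T powr p)"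
    using assms by (intro mult_left_mono) auto
  then show ?thesis
    by (simp add: beta_seq_def mult_ac)
qed

text \<open>Concavity of \<open>x powr (1 - p)\<close>, in the form of the weighted mean inequality between
  \<open>1 - 1 / (T + 1)\<close> and \<open>1\<close>, makes the increments dominate the summands.\<close>

lemma sum_powr_minus_le:
  assumes p: "0 < p" "p < 1"
  shows "(\<Sum>t = 1..T. real t powr - p) \<le> real T powr (1 - p) / (1 - p)"
proof (induction T)
  case 0
  show ?case
    by simp
next
  case (Suc T)
  define s where "s = real (Suc T)"
  have s: "s > 0" "real T = s * (1 - 1 / s)" "1 - 1 / s \<ge> 0"
    by (auto simp: s_def field_simps)
  have "(1 - 1 / s) powr (1 - p) * 1 powr p \<le> (1 - p) * (1 - 1 / s) + p * 1"
  proof (cases "1 - 1 / s = 0")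
    case True
    show ?thesis
      unfolding True using p by simp
  next
    case False
    then have "0 < 1 - 1 / s"
      using s(3) by linarith
    then show ?thesis
      using p by (intro Youngs_inequality_0) simp_all
  qed
  then have "(1 - 1 / s) powr (1 - p) \<le> 1 - (1 - p) / s"
    by (simp add: algebra_simps diff_divide_distrib)
  then have "s powr (1 - p) * (1 - 1 / s) powr (1 - p) \<le> s powr (1 - p) * (1 - (1 - p) / s)"
    by (intro mult_left_mono) auto
  moreover have "real T powr (1 - p) = s powr (1 - p) * (1 - 1 / s) powr (1 - p)"
    unfolding s(2) using s by (simp add: powr_mult)
  moreover have "s powr (1 - p) * (1 - (1 - p) / s) = s powr (1 - p) - (1 - p) * s powr - p"
  proof -
    have "s powr (1 - p) = s * s powr - p"
      using s by (simp add: powr_diff powr_minus divide_inverse)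
    then show ?thesis
      using s by (simp add: field_simps)
  qed
  ultimately have "(1 - p) * s powr - p \<le> s powr (1 - p) - real T powr (1 - p)"
    by linarith
  then have "s powr - p \<le> (s powr (1 - p) - real T powr (1 - p)) / (1 - p)"
    using p by (simp add: pos_le_divide_eq mult.commute)
  then show ?case
    using Suc by (simp add: s_def diff_divide_distrib)
qed

text \<open>A bound on weighted squares gives a bound on the sum of the terms themselves: for every
  \<open>s > 0\<close>, \<open>q \<le> (s * q\<^sup>2 / \<beta> + \<beta> / s) / 2\<close>. Since the weights \<open>\<beta>\<close> up to \<open>T\<close> are of order
  \<open>T powr p\<close>, the choice \<open>s = T powr ((1 + p) / 2)\<close> balances the two contributions.\<close>

lemma sum_le_of_weighted_squares:
  fixes q \<beta> :: "nat \<Rightarrow> real"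
  assumes T: "1 \<le> T"
    and \<beta>: "\<And>t. t \<in> {1..T} \<Longrightarrow> 0 < \<beta> t" "\<And>t. t \<in> {1..T} \<Longrightarrow> \<beta> t \<le> B * real T powr p"
    and E: "(\<Sum>t = 1..T. (q t)\<^sup>2 / \<beta> t) \<le> E"
  shows "(\<Sum>t = 1..T. q t) \<le> (E + B) / 2 * real T powr ((1 + p) / 2)"
proof -
  define s where "s = real T powr ((1 + p) / 2)"
  have s: "s > 0"
    using T by (simp add: s_def)
  have "q t \<le> (s * ((q t)\<^sup>2 / \<beta> t) + \<beta> t / s) / 2" if "t \<in> {1..T}" for t
  proof -
    have b: "\<beta> t > 0"
      using \<beta> that by blast
    have "0 \<le> (s * q t - \<beta> t)\<^sup>2 / (s * \<beta> t)"
      using s b by simp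
    also have "\<dots> = s * ((q t)\<^sup>2 / \<beta> t) + \<beta> t / s - 2 * q t"
      using s b by (simp add: power2_eq_square field_simps)
    finally show ?thesis
      by simp
  qed
  then have "(\<Sum>t = 1..T. q t) \<le> (\<Sum>t = 1..T. (s * ((q t)\<^sup>2 / \<beta> t) + \<beta> t / s) / 2)"
    by (rule sum_mono)
  also have "\<dots> = (s * (\<Sum>t = 1..T. (q t)\<^sup>2 / \<beta> t) + (\<Sum>t = 1..T. \<beta> t) / s) / 2"
    by (simp add: sum.distrib sum_distrib_left sum_divide_distrib add_divide_distrib)
  also have "\<dots> \<le> (s * E + (real T * (B * real T powr p)) / s) / 2"
  proof -
    have "(\<Sum>t = 1..T. \<beta> t) \<le> (\<Sum>t = 1..T. B * real T powr p)"
      using \<beta> by (intro sum_mono) auto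
    then have a: "(\<Sum>t = 1..T. \<beta> t) / s \<le> (real T * (B * real T powr p)) / s"
      using s by (intro divide_right_mono) auto
    have b: "s * (\<Sum>t = 1..T. (q t)\<^sup>2 / \<beta> t) \<le> s * E"
      using E s by (intro mult_left_mono) auto
    show ?thesis
      by (rule divide_right_mono[OF add_mono[OF b a]]) simp
  qed
  also have "real T * (B * real T powr p) = B * (s * s)"
  proof -
    have "s * s = real T powr (1 + p)"
      by (simp add: s_def powr_add[symmetric])
    then show ?thesis
      using T by (simp add: powr_add)
  qed
  also have "(s * E + B * (s * s) / s) / 2 = (E + B) / 2 * s"
    using s by (simp add: field_simps)
  finally show ?thesis
    by (simp add: s_def)
qed

section \<open>Boundedness along a run\<close>

text \<open>Any exponent \<open>p\<close> between 0 and 1 is covered. The subgradients \<open>V\<close> of \<open>g\<close>, the initial step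
  factors \<open>b\<close> and the accepted exponents \<open>j\<close> are parameters, so that a run of the method is a
  choice of all its sequences.\<close>

locale oadmm_setting =
  fixes f g :: "real ^ 'r ^ 'n \<Rightarrow> real"
    and h :: "real ^ 'm \<Rightarrow> real"
    and A :: "real ^ 'r ^ 'n \<Rightarrow> real ^ 'm"
    and Retr :: "real ^ 'r ^ 'n \<Rightarrow> real ^ 'r ^ 'n \<Rightarrow> real ^ 'r ^ 'n"
    and L_f C_f C_g C_h W_h k1 k2 :: real
    and p \<xi> \<sigma> \<tau> \<beta>0 \<rho> \<gamma> \<delta> b_lo b_hi :: real
    and X :: "nat \<Rightarrow> real ^ 'r ^ 'n"
    and y yb z :: "nat \<Rightarrow> real ^ 'm"
    and V :: "nat \<Rightarrow> real ^ 'r ^ 'n"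
    and b :: "nat \<Rightarrow> real"
    and j :: "nat \<Rightarrow> nat"
  assumes A_linear: "linear A"
    and f_diff: "\<And>U. f differentiable (at U)"
    and f_smooth: "L_f-lipschitz_on UNIV (grad f)"
    and f_grad_bound: "\<And>U. U \<in> stiefel \<Longrightarrow> norm (grad f U) \<le> C_f"
    and g_convex: "convex_on UNIV g"
    and g_lipschitz: "C_g-lipschitz_on UNIV g"
    and h_lipschitz: "C_h-lipschitz_on UNIV h"
    and W_h_nonneg: "W_h \<ge> 0"
    and h_weakly_convex: "weakly_convex W_h h"
    and retraction: "retraction_with_consts Retr k1 k2"
    and p: "0 < p" "p < 1"
    and xi: "0 < \<xi>" "\<xi> < 1"
    and sigma: "1 \<le> \<sigma>" "\<sigma> < 2"
    and tau: "\<tau> \<ge> 4 / (2 - \<sigma>)"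
    and beta0: "\<beta>0 > 0" "\<beta>0 \<ge> 2 * \<tau> * W_h"
    and rho: "\<rho> > 0"
    and gamma: "0 < \<gamma>" "\<gamma> < 1"
    and delta: "0 < \<delta>" "\<delta> < 1 / max 1 (2 * \<rho>)"
    and b_lo: "0 < b_lo"
begin

definition \<beta> :: "nat \<Rightarrow> real" where
  "\<beta> = beta_seq \<beta>0 \<xi> p"

definition G :: "nat \<Rightarrow> real ^ 'r ^ 'n" where
  "G t = grad (\<lambda>U. S_fun f A U (y t) (z t) (\<beta> t)) (X t) - V t"

definition D :: "nat \<Rightarrow> real ^ 'r ^ 'n" where
  "D t = G_rho \<rho> (X t) (G t)"

definition step :: "nat \<Rightarrow> nat \<Rightarrow> real" where
  "step t i = b t * \<gamma> ^ i / \<beta> t"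

definition Ldot :: "nat \<Rightarrow> real ^ 'r ^ 'n \<Rightarrow> ereal" where
  "Ldot t U = L_fun f g h A \<tau> U (y t) (z t) (\<beta> t)"

definition center :: "nat \<Rightarrow> real ^ 'm" where
  "center t = y t - (1 / \<beta> t) *\<^sub>R grad (\<lambda>w. S_fun f A (X (Suc t)) w (z t) (\<beta> t)) (y t)"

end

locale oadmm_run = oadmm_setting +
  assumes X_0: "X 0 \<in> stiefel"
    and V_subgrad: "\<And>t. V t \<in> limiting_subdiff g (X t)"
    and b_gt: "\<And>t. b_lo < b t"
    and accepted: "\<And>t. armijo (Ldot t) Retr \<delta> (X t) (D t) (step t (j t))"
    and rejected: "\<And>t i. i < j t \<Longrightarrow> \<not> armijo (Ldot t) Retr \<delta> (X t) (D t) (step t i)"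
    and X_Suc: "\<And>t. X (Suc t) = Retr (X t) (- step t (j t) *\<^sub>R D t)"
    and y_Suc: "\<And>t. is_arg_min (\<lambda>w. moreau_env h (\<tau> / \<beta> t) w + \<beta> t / 2 * (norm (w - center t))\<^sup>2)
      (\<lambda>_. True) (y (Suc t))"
    and yb_Suc: "\<And>t. is_arg_min (\<lambda>v. h v + 1 / (2 * (\<tau> / \<beta> t + 1 / \<beta> t)) * (norm (v - center t))\<^sup>2)
      (\<lambda>_. True) (yb (Suc t))"
    and z_Suc: "\<And>t. z (Suc t) = z t + (\<sigma> * \<beta> t) *\<^sub>R (A (X (Suc t)) - y (Suc t))"
begin

lemma beta_ge: "\<beta>0 \<le> \<beta> t"
  unfolding \<beta>_def using beta0 xi by (intro beta_seq_ge)

lemma beta_pos: "\<beta> t > 0"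
  using beta_ge[of t] beta0 by linarith

lemma beta_mono: "\<beta> t \<le> \<beta> (Suc t)"
  unfolding \<beta>_def using beta0 xi p by (intro beta_seq_mono)

lemma beta_Suc_le: "\<beta> (Suc t) \<le> 2 * \<beta> t"
  unfolding \<beta>_def using beta0 xi p by (intro beta_seq_Suc_le)

lemma beta_weak_convexity: "2 * \<tau> * W_h \<le> \<beta> t"
  using beta_ge[of t] beta0 by linarith

lemma tau_sigma: "\<tau> * (2 - \<sigma>) \<ge> 4"
  using tau sigma by (simp add: pos_divide_le_eq)

lemma tau_ge: "\<tau> \<ge> 4"
proof -
  have "\<tau> > 0"
    using tau sigma by (smt (verit) divide_pos_pos)
  then have "\<tau> * (2 - \<sigma>) \<le> \<tau> * 1"
    using sigma by (intro mult_left_mono) auto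
  then show ?thesis
    using tau_sigma by simp
qed

lemma C_h_nonneg: "C_h \<ge> 0"
  using h_lipschitz by (rule lipschitz_on_nonneg)

lemma k2_pos: "k2 > 0"
  using retraction by (auto simp: retraction_with_consts_def)

lemma Retr_stiefel: "U \<in> stiefel \<Longrightarrow> Retr U \<Delta> \<in> stiefel"
  using retraction by (auto simp: retraction_with_consts_def)

lemma X_stiefel: "X t \<in> stiefel"
  by (induction t) (auto simp: X_0 X_Suc Retr_stiefel)

abbreviation "A_norm \<equiv> onorm A"

lemma A_bounded_linear: "bounded_linear A"
  using A_linear by (simp add: linear_conv_bounded_linear)

lemma norm_A: "norm (A v) \<le> A_norm * norm v"
  using onorm[OF A_bounded_linear] .

lemma A_norm_nonneg: "A_norm \<ge> 0"
  using onorm_pos_le[OF A_bounded_linear] .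

lemma norm_adjoint_A: "norm (adjoint A w) \<le> A_norm * norm w"
proof -
  have "(norm (adjoint A w))\<^sup>2 = A (adjoint A w) \<bullet> w"
    by (simp add: power2_norm_eq_inner adjoint_works[OF A_linear])
  also have "\<dots> \<le> norm (A (adjoint A w)) * norm w"
    by (rule norm_cauchy_schwarz)
  also have "\<dots> \<le> A_norm * norm (adjoint A w) * norm w"
    using norm_A by (rule mult_right_mono) simp
  finally show ?thesis
    using A_norm_nonneg by (cases "norm (adjoint A w) = 0") (auto simp: power2_eq_square mult_ac)
qed

lemma adjoint_A_add: "adjoint A (v + w) = adjoint A v + adjoint A w"
  using linear_add[OF adjoint_linear[OF A_linear]] .

lemma grad_S_X: "grad (\<lambda>U. S_fun f A U w \<zeta> B) U = grad f U + adjoint A (\<zeta> + B *\<^sub>R (A U - w))"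
proof (rule grad_eqI)
  have 1: "(f has_derivative (\<lambda>d. d \<bullet> grad f U)) (at U)"
    using differentiable_imp_GDERIV_grad[OF f_diff] by (simp add: gderiv_def)
  have 2: "(A has_derivative A) (at U)"
    using A_bounded_linear by (rule bounded_linear_imp_has_derivative)
  have "((\<lambda>U. f U + \<zeta> \<bullet> (A U - w) + B / 2 * ((A U - w) \<bullet> (A U - w))) has_derivative
      (\<lambda>d. d \<bullet> grad f U + \<zeta> \<bullet> A d + B / 2 * ((A U - w) \<bullet> A d + A d \<bullet> (A U - w)))) (at U)"
    by (auto intro!: derivative_eq_intros 1 2)
  moreover have "(\<lambda>d. d \<bullet> grad f U + \<zeta> \<bullet> A d + B / 2 * ((A U - w) \<bullet> A d + A d \<bullet> (A U - w)))
      = (\<lambda>d. d \<bullet> (grad f U + adjoint A (\<zeta> + B *\<^sub>R (A U - w))))"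
    by (simp add: fun_eq_iff inner_add_right adjoint_works[OF A_linear] inner_commute[of "A U - w"]
        inner_commute[of \<zeta>])
  ultimately show "GDERIV (\<lambda>U. S_fun f A U w \<zeta> B) U :> grad f U + adjoint A (\<zeta> + B *\<^sub>R (A U - w))"
    by (simp add: gderiv_def S_fun_def power2_norm_eq_inner)
qed

lemma grad_S_y: "grad (\<lambda>w. S_fun f A U w \<zeta> B) w = - \<zeta> - B *\<^sub>R (A U - w)"
proof (rule grad_eqI)
  have "((\<lambda>w. f U + \<zeta> \<bullet> (A U - w) + B / 2 * ((A U - w) \<bullet> (A U - w))) has_derivative
      (\<lambda>d. \<zeta> \<bullet> (- d) + B / 2 * ((A U - w) \<bullet> (- d) + (- d) \<bullet> (A U - w)))) (at w)"
    by (auto intro!: derivative_eq_intros)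
  moreover have "(\<lambda>d. \<zeta> \<bullet> (- d) + B / 2 * ((A U - w) \<bullet> (- d) + (- d) \<bullet> (A U - w)))
      = (\<lambda>d. d \<bullet> (- \<zeta> - B *\<^sub>R (A U - w)))"
    by (simp add: fun_eq_iff inner_diff_right[of _ "- \<zeta>"] inner_commute[of "A U - w"]
        inner_commute[of \<zeta>])
  ultimately show "GDERIV (\<lambda>w. S_fun f A U w \<zeta> B) w :> - \<zeta> - B *\<^sub>R (A U - w)"
    by (simp add: gderiv_def S_fun_def power2_norm_eq_inner)
qed

lemma G_eq: "G t = grad f (X t) + adjoint A (z t + \<beta> t *\<^sub>R (A (X t) - y t)) - V t"
  by (simp add: G_def grad_S_X)

lemma center_eq: "center t = A (X (Suc t)) + (1 / \<beta> t) *\<^sub>R z t"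
  using beta_pos[of t] by (simp add: center_def grad_S_y scaleR_diff_right scaleR_add_right)

text \<open>The gradient of the Moreau envelope at \<open>y (Suc t)\<close>, by the optimality condition of the
  \<open>y\<close>-update. It is also a subgradient of \<open>h\<close> at the prox point, hence bounded.\<close>

definition env_grad where
  "env_grad t = z t + \<beta> t *\<^sub>R (A (X (Suc t)) - y (Suc t))"

lemma env_grad_center: "env_grad t = \<beta> t *\<^sub>R (center t - y (Suc t))"
  using beta_pos[of t] by (simp add: env_grad_def center_eq scaleR_diff_right scaleR_add_right)

lemma
  shows y_eq_yb: "y (Suc t) = yb (Suc t) + (\<tau> / \<beta> t) *\<^sub>R env_grad t"
    and env_grad_subgradient: "env_grad t \<in> frechet_subdiff h (yb (Suc t))"
    and env_value: "moreau_env h (\<tau> / \<beta> t) (y (Suc t))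
      = h (yb (Suc t)) + \<tau> / (2 * \<beta> t) * (norm (env_grad t))\<^sup>2"
    and y_growth: "moreau_env h (\<tau> / \<beta> t) w + \<beta> t / 2 * (norm (w - center t))\<^sup>2
      \<ge> moreau_env h (\<tau> / \<beta> t) (y (Suc t)) + \<beta> t / 2 * (norm (y (Suc t) - center t))\<^sup>2
        + \<beta> t / 2 * (1 - 1 / \<tau>) * (norm (w - y (Suc t)))\<^sup>2"
proof -
  have \<tau>: "\<tau> > 1"
    using tau_ge by simp
  note step = envelope_step[OF h_lipschitz h_weakly_convex W_h_nonneg beta_pos[of t]
      beta_weak_convexity[of t] \<tau> yb_Suc[of t] y_Suc[of t]]
  show "y (Suc t) = yb (Suc t) + (\<tau> / \<beta> t) *\<^sub>R env_grad t"
    unfolding env_grad_center by (rule step)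
  show "env_grad t \<in> frechet_subdiff h (yb (Suc t))"
    unfolding env_grad_center by (rule step)
  show "moreau_env h (\<tau> / \<beta> t) (y (Suc t)) = h (yb (Suc t)) + \<tau> / (2 * \<beta> t) * (norm (env_grad t))\<^sup>2"
    unfolding env_grad_center by (rule step)
  show "moreau_env h (\<tau> / \<beta> t) w + \<beta> t / 2 * (norm (w - center t))\<^sup>2
      \<ge> moreau_env h (\<tau> / \<beta> t) (y (Suc t)) + \<beta> t / 2 * (norm (y (Suc t) - center t))\<^sup>2
        + \<beta> t / 2 * (1 - 1 / \<tau>) * (norm (w - y (Suc t)))\<^sup>2"
    by (rule step)
qed

lemma norm_env_grad: "norm (env_grad t) \<le> C_h"
  using frechet_subdiff_norm_le[OF env_grad_subgradient h_lipschitz] .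

definition dz where
  "dz t = z (Suc t) - z t"

lemma dz_residual: "dz t = (\<sigma> * \<beta> t) *\<^sub>R (A (X (Suc t)) - y (Suc t))"
  by (simp add: dz_def z_Suc)

lemma residual_dz: "A (X (Suc t)) - y (Suc t) = (1 / (\<sigma> * \<beta> t)) *\<^sub>R dz t"
  using beta_pos[of t] sigma by (simp add: dz_residual)

lemma dz_env_grad: "dz t = \<sigma> *\<^sub>R (env_grad t - z t)"
  by (simp add: dz_residual env_grad_def)

lemma dz_Suc: "dz (Suc t) = (1 - \<sigma>) *\<^sub>R dz t + \<sigma> *\<^sub>R (env_grad (Suc t) - env_grad t)"
proof -
  have "dz (Suc t) = \<sigma> *\<^sub>R (env_grad (Suc t) - z (Suc t))"
    by (rule dz_env_grad)
  also have "\<dots> = \<sigma> *\<^sub>R (env_grad (Suc t) - env_grad t) + \<sigma> *\<^sub>R (env_grad t - z t) - \<sigma> *\<^sub>R dz t"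
    by (simp add: dz_def algebra_simps)
  also have "\<dots> = (1 - \<sigma>) *\<^sub>R dz t + \<sigma> *\<^sub>R (env_grad (Suc t) - env_grad t)"
    unfolding dz_env_grad[of t, symmetric] by (simp add: algebra_simps)
  finally show ?thesis .
qed

definition Z :: real where
  "Z = norm (z 0) + \<sigma> * C_h / (2 - \<sigma>)"

text \<open>The multiplier update reads \<open>z (Suc t) = (1 - \<sigma>) *\<^sub>R z t + \<sigma> *\<^sub>R env_grad t\<close>, a contraction
  because \<open>\<bar>1 - \<sigma>\<bar> < 1\<close>, driven by bounded vectors.\<close>

lemma norm_z: "norm (z t) \<le> Z"
proof (induction t)
  case 0
  show ?case
    using sigma C_h_nonneg by (simp add: Z_def)
next
  case (Suc t)
  have "z (Suc t) = (1 - \<sigma>) *\<^sub>R z t + \<sigma> *\<^sub>R env_grad t"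
    using dz_env_grad[of t] by (simp add: dz_def algebra_simps)
  then have "norm (z (Suc t)) \<le> norm ((1 - \<sigma>) *\<^sub>R z t) + norm (\<sigma> *\<^sub>R env_grad t)"
    by (metis norm_triangle_ineq)
  also have "\<dots> = (\<sigma> - 1) * norm (z t) + \<sigma> * norm (env_grad t)"
    using sigma by simp
  also have "\<dots> \<le> (\<sigma> - 1) * Z + \<sigma> * C_h"
    using Suc sigma norm_env_grad[of t] by (intro add_mono mult_left_mono) auto
  also have "\<dots> \<le> Z"
  proof -
    have "(2 - \<sigma>) * Z = (2 - \<sigma>) * norm (z 0) + \<sigma> * C_h"
      using sigma by (simp add: Z_def distrib_left)
    moreover have "(2 - \<sigma>) * norm (z 0) \<ge> 0"
      using sigma by simp
    ultimately show ?thesis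
      by (simp add: algebra_simps)
  qed
  finally show ?case .
qed

lemma Z_nonneg: "Z \<ge> 0"
  using norm_z[of 0] norm_ge_zero order_trans by blast

lemma norm_dz: "norm (dz t) \<le> 2 * Z"
  using norm_triangle_ineq4[of "z (Suc t)" "z t"] norm_z[of t] norm_z[of "Suc t"]
  by (simp add: dz_def)

lemma norm_residual: "norm (A (X (Suc t)) - y (Suc t)) \<le> 2 * Z / \<beta> t"
proof -
  have "norm (A (X (Suc t)) - y (Suc t)) = norm (dz t) / (\<sigma> * \<beta> t)"
    using beta_pos[of t] sigma by (simp add: residual_dz)
  also have "\<dots> \<le> (2 * Z) / (1 * \<beta> t)"
    using beta_pos[of t] sigma norm_dz[of t] Z_nonneg by (intro frac_le mult_right_mono) auto
  finally show ?thesis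
    by simp
qed

definition R :: real where
  "R = 4 * Z + \<beta>0 * norm (A (X 0) - y 0)"

text \<open>For positive \<open>t\<close> the residual is controlled by the previous penalty, which is at least half
  the current one; the residual at the start is arbitrary.\<close>

lemma scaled_residual: "\<beta> t * norm (A (X t) - y t) \<le> R"
proof (cases t)
  case 0
  then show ?thesis
    using Z_nonneg by (simp add: R_def \<beta>_def beta_seq_def)
next
  case (Suc s)
  have "\<beta> t * norm (A (X t) - y t) \<le> \<beta> t * (2 * Z / \<beta> s)"
    unfolding Suc using norm_residual[of s] beta_pos[of "Suc s"] by (intro mult_left_mono) simp_all
  also have "\<dots> \<le> (2 * \<beta> s) * (2 * Z / \<beta> s)"
    using beta_Suc_le[of s] beta_pos[of s] Z_nonneg unfolding Suc by (intro mult_right_mono) auto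
  also have "\<dots> = 4 * Z"
    using beta_pos[of s] by simp
  also have "\<dots> \<le> R"
    using beta0 by (simp add: R_def)
  finally show ?thesis .
qed

definition G_max :: real where
  "G_max = C_f + A_norm * (Z + R) + C_g"

lemma norm_G: "norm (G t) \<le> G_max"
proof -
  have "norm (z t + \<beta> t *\<^sub>R (A (X t) - y t)) \<le> Z + R"
    using norm_triangle_ineq[of "z t" "\<beta> t *\<^sub>R (A (X t) - y t)"] norm_z[of t] scaled_residual[of t]
      beta_pos[of t] by simp
  then have "norm (adjoint A (z t + \<beta> t *\<^sub>R (A (X t) - y t))) \<le> A_norm * (Z + R)"
    using norm_adjoint_A A_norm_nonneg by (meson mult_left_mono order_trans)
  moreover have "norm (V t) \<le> C_g"
    using limiting_subdiff_norm_le[OF V_subgrad g_lipschitz] .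
  moreover have "norm (grad f (X t)) \<le> C_f"
    using f_grad_bound[OF X_stiefel] .
  moreover have "norm (G t) \<le> norm (grad f (X t) + adjoint A (z t + \<beta> t *\<^sub>R (A (X t) - y t))) + norm (V t)"
    unfolding G_eq by (rule norm_triangle_ineq4)
  moreover have "norm (grad f (X t) + adjoint A (z t + \<beta> t *\<^sub>R (A (X t) - y t)))
      \<le> norm (grad f (X t)) + norm (adjoint A (z t + \<beta> t *\<^sub>R (A (X t) - y t)))"
    by (rule norm_triangle_ineq)
  ultimately show ?thesis
    unfolding G_max_def by linarith
qed

lemma G_max_nonneg: "G_max \<ge> 0"
  using norm_G[of 0] norm_ge_zero order_trans by blast

end

section \<open>The line search accepts steps of order 1 / beta\<close>

context oadmm_run
begin

definition Lagr where
  "Lagr U w \<zeta> B = S_fun f A U w \<zeta> B - g U + moreau_env h (\<tau> / B) w"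

lemma L_fun_eq_Lagr: "U \<in> stiefel \<Longrightarrow> L_fun f g h A \<tau> U w \<zeta> B = ereal (Lagr U w \<zeta> B)"
  by (simp add: L_fun_def Lagr_def set_iota_def)

lemma armijo_iff:
  "armijo (Ldot t) Retr \<delta> (X t) (D t) s \<longleftrightarrow>
    Lagr (Retr (X t) (- s *\<^sub>R D t)) (y t) (z t) (\<beta> t) - Lagr (X t) (y t) (z t) (\<beta> t)
      \<le> - \<delta> * s * (norm (D t))\<^sup>2"
  by (simp add: armijo_def Ldot_def L_fun_eq_Lagr X_stiefel Retr_stiefel)

text \<open>The smooth part is expanded around \<open>X t\<close>; the concave part \<open>- g\<close> lies below its
  linearization, so the subgradient chosen in \<open>G t\<close> serves every \<open>U\<close>.\<close>

lemma Lagr_X_upper_bound: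
  fixes t :: nat and U
  defines "e \<equiv> U - X t"
  shows "Lagr U (y t) (z t) (\<beta> t) - Lagr (X t) (y t) (z t) (\<beta> t)
    \<le> G t \<bullet> e + (L_f + \<beta> t * A_norm\<^sup>2 / 2) * (norm e)\<^sup>2"
proof -
  define r where "r = A (X t) - y t"
  have AU: "A U - y t = r + A e"
    using linear_diff[OF A_linear] by (simp add: r_def e_def)
  have f_le: "f U - f (X t) \<le> grad f (X t) \<bullet> e + L_f * (norm e)\<^sup>2"
    using lipschitz_grad_upper_bound[OF f_diff f_smooth, of U "X t"] by (simp add: e_def)
  have g_ge: "g U - g (X t) \<ge> V t \<bullet> e"
    using convex_limiting_subgradient[OF g_convex V_subgrad[of t], of U] by (simp add: e_def)
  have "(norm (r + A e))\<^sup>2 = (norm r)\<^sup>2 + 2 * (r \<bullet> A e) + (norm (A e))\<^sup>2"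
    by (simp add: power2_norm_eq_inner inner_add_left inner_add_right inner_commute[of "A e" r])
  then have "\<beta> t / 2 * (norm (r + A e))\<^sup>2
      = \<beta> t / 2 * (norm r)\<^sup>2 + \<beta> t * (r \<bullet> A e) + \<beta> t / 2 * (norm (A e))\<^sup>2"
    by (simp add: distrib_left)
  moreover have "z t \<bullet> (r + A e) = z t \<bullet> r + z t \<bullet> A e"
    by (rule inner_add_right)
  moreover have "adjoint A (z t + \<beta> t *\<^sub>R r) \<bullet> e = z t \<bullet> A e + \<beta> t * (r \<bullet> A e)"
  proof -
    have "adjoint A (z t + \<beta> t *\<^sub>R r) \<bullet> e = (z t + \<beta> t *\<^sub>R r) \<bullet> A e"
      using adjoint_works[OF A_linear, of e "z t + \<beta> t *\<^sub>R r"] by (simp add: inner_commute)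
    then show ?thesis
      by (simp add: inner_add_left)
  qed
  ultimately have S_eq: "S_fun f A U (y t) (z t) (\<beta> t) - S_fun f A (X t) (y t) (z t) (\<beta> t)
      = f U - f (X t) + adjoint A (z t + \<beta> t *\<^sub>R r) \<bullet> e + \<beta> t / 2 * (norm (A e))\<^sup>2"
    unfolding S_fun_def AU r_def[symmetric] by linarith
  have "(norm (A e))\<^sup>2 \<le> (A_norm * norm e)\<^sup>2"
    using norm_A by (rule power_mono) simp
  then have "\<beta> t / 2 * (norm (A e))\<^sup>2 \<le> \<beta> t / 2 * (A_norm * norm e)\<^sup>2"
    using beta_pos[of t] by (intro mult_left_mono) auto
  then have "\<beta> t / 2 * (norm (A e))\<^sup>2 \<le> \<beta> t * A_norm\<^sup>2 / 2 * (norm e)\<^sup>2"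
    by (simp add: power_mult_distrib)
  moreover have "G t \<bullet> e = grad f (X t) \<bullet> e + adjoint A (z t + \<beta> t *\<^sub>R r) \<bullet> e - V t \<bullet> e"
    by (simp add: G_eq r_def inner_add_left inner_diff_left)
  moreover have "(L_f + \<beta> t * A_norm\<^sup>2 / 2) * (norm e)\<^sup>2
      = L_f * (norm e)\<^sup>2 + \<beta> t * A_norm\<^sup>2 / 2 * (norm e)\<^sup>2"
    by (rule distrib_right)
  ultimately show ?thesis
    using S_eq f_le g_ge unfolding Lagr_def by linarith
qed

definition search_slack :: real where
  "search_slack = 1 / max 1 (2 * \<rho>) - \<delta>"

text \<open>Relative to \<open>\<beta> t\<close>, this bounds the curvature of the objective along the retraction curve.
  The added 1 only keeps it positive.\<close>

definition curvature :: real where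
  "curvature = G_max / \<beta>0 * k2 / 2 + (L_f / \<beta>0 + A_norm\<^sup>2 / 2) * k1\<^sup>2 + 1"

lemma curvature_ge: "G_max * k2 / 2 + (L_f + \<beta> t * A_norm\<^sup>2 / 2) * k1\<^sup>2 \<le> \<beta> t * curvature"
proof -
  have q: "1 \<le> \<beta> t / \<beta>0"
    using beta_ge[of t] beta0 by simp
  have "0 \<le> G_max * k2 / 2" "0 \<le> L_f * k1\<^sup>2"
    using G_max_nonneg k2_pos lipschitz_on_nonneg[OF f_smooth] by auto
  then have "1 * (G_max * k2 / 2) \<le> \<beta> t / \<beta>0 * (G_max * k2 / 2)"
    "1 * (L_f * k1\<^sup>2) \<le> \<beta> t / \<beta>0 * (L_f * k1\<^sup>2)"
    using mult_right_mono[OF q] by blast+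
  then show ?thesis
    using beta_pos[of t] by (simp add: curvature_def distrib_left distrib_right)
qed

lemma curvature_pos: "curvature > 0"
proof -
  have "0 \<le> G_max / \<beta>0 * k2 / 2" "0 \<le> (L_f / \<beta>0 + A_norm\<^sup>2 / 2) * k1\<^sup>2"
    using G_max_nonneg k2_pos lipschitz_on_nonneg[OF f_smooth] beta0 by auto
  then show ?thesis
    unfolding curvature_def by linarith
qed

lemma search_slack_pos: "search_slack > 0"
  using delta by (simp add: search_slack_def)

text \<open>Along the retraction curve the first order change is \<open>- s * (G t \<bullet> D t)\<close>, at most
  \<open>- s * (norm (D t))\<^sup>2 / max 1 (2 * \<rho>)\<close>, and the error is of second order: the retraction
  deviates quadratically from the tangent step, at a cost proportional to the bounded \<open>G t\<close>.\<close>

lemma armijo_of_small_step: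
  assumes s: "0 < s" "s \<le> search_slack / curvature / \<beta> t"
  shows "armijo (Ldot t) Retr \<delta> (X t) (D t) s"
proof -
  define U where "U = Retr (X t) (- s *\<^sub>R D t)"
  define e where "e = U - X t"
  define N where "N = (norm (D t))\<^sup>2"
  have tang: "- s *\<^sub>R D t \<in> tangent (X t)"
    unfolding D_def by (rule scaleR_G_rho_tangent[OF X_stiefel])
  then have "norm e \<le> k1 * norm (- s *\<^sub>R D t)"
    "norm (e - (- s *\<^sub>R D t)) \<le> 1 / 2 * k2 * (norm (- s *\<^sub>R D t))\<^sup>2"
    using retraction X_stiefel unfolding retraction_with_consts_def e_def U_def by blast+
  then have e1: "norm e \<le> k1 * (s * norm (D t))"
    and e2: "norm (e + s *\<^sub>R D t) \<le> k2 / 2 * (s\<^sup>2 * N)"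
    using s by (simp_all add: N_def power_mult_distrib)
  have "(norm e)\<^sup>2 \<le> (k1 * (s * norm (D t)))\<^sup>2"
    using e1 by (rule power_mono) simp
  then have e_sq: "(norm e)\<^sup>2 \<le> k1\<^sup>2 * (s\<^sup>2 * N)"
    by (simp add: power_mult_distrib N_def)
  have "G t \<bullet> (e + s *\<^sub>R D t) \<le> norm (G t) * norm (e + s *\<^sub>R D t)"
    by (rule norm_cauchy_schwarz)
  also have "\<dots> \<le> G_max * (k2 / 2 * (s\<^sup>2 * N))"
    using norm_G[of t] e2 G_max_nonneg by (intro mult_mono) auto
  finally have "G t \<bullet> e \<le> G_max * k2 / 2 * (s\<^sup>2 * N) - s * (G t \<bullet> D t)"
    by (simp add: inner_add_right)
  moreover have "s * (N / max 1 (2 * \<rho>)) \<le> s * (G t \<bullet> D t)"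
  proof -
    have "N \<le> max 1 (2 * \<rho>) * (G t \<bullet> D t)"
      unfolding N_def D_def by (rule inner_G_rho_ge[OF X_stiefel rho])
    then have "N / max 1 (2 * \<rho>) \<le> G t \<bullet> D t"
      by (simp add: pos_divide_le_eq mult.commute)
    then show ?thesis
      using s by (intro mult_left_mono) auto
  qed
  moreover have "(L_f + \<beta> t * A_norm\<^sup>2 / 2) * (norm e)\<^sup>2
      \<le> (L_f + \<beta> t * A_norm\<^sup>2 / 2) * (k1\<^sup>2 * (s\<^sup>2 * N))"
    using e_sq beta_pos[of t] lipschitz_on_nonneg[OF f_smooth] by (intro mult_left_mono) auto
  ultimately have "Lagr U (y t) (z t) (\<beta> t) - Lagr (X t) (y t) (z t) (\<beta> t)
      \<le> (G_max * k2 / 2 + (L_f + \<beta> t * A_norm\<^sup>2 / 2) * k1\<^sup>2) * (s\<^sup>2 * N) - s * (N / max 1 (2 * \<rho>))"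
    using Lagr_X_upper_bound[of U t, folded e_def] unfolding distrib_right mult.assoc by linarith
  also have "\<dots> \<le> \<beta> t * curvature * (s\<^sup>2 * N) - s * (N / max 1 (2 * \<rho>))"
    using curvature_ge[of t] by (intro diff_right_mono mult_right_mono) (auto simp: N_def)
  also have "\<dots> = (s * (\<beta> t * curvature)) * (s * N) - s * (N / max 1 (2 * \<rho>))"
    by (simp add: power2_eq_square mult_ac)
  also have "\<dots> \<le> search_slack * (s * N) - s * (N / max 1 (2 * \<rho>))"
  proof -
    have "s * (\<beta> t * curvature) \<le> search_slack / curvature / \<beta> t * (\<beta> t * curvature)"
      using s curvature_pos beta_pos[of t] by (intro mult_right_mono) auto
    also have "\<dots> = search_slack"
      using curvature_pos beta_pos[of t] by simp
    finally show ?thesis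
      using s by (intro diff_right_mono mult_right_mono) (auto simp: N_def)
  qed
  also have "\<dots> = - \<delta> * s * N"
    by (simp add: search_slack_def algebra_simps)
  finally show ?thesis
    unfolding armijo_iff U_def N_def .
qed

definition step_const :: real where
  "step_const = min b_lo (\<gamma> * (search_slack / curvature))"

lemma step_const_pos: "step_const > 0"
  using b_lo gamma search_slack_pos curvature_pos by (simp add: step_const_def)

text \<open>Either the first trial step is accepted, or the previous trial was rejected and therefore
  exceeded the threshold below which acceptance is certain.\<close>

lemma step_lower_bound: "step_const / \<beta> t \<le> step t (j t)"
proof (cases "j t")
  case 0
  have "step_const \<le> b t"
    using b_gt[of t] by (simp add: step_const_def)
  then show ?thesis
    using beta_pos[of t] by (simp add: step_def 0 divide_right_mono)
next
  case (Suc i)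
  have "0 < step t i"
    using b_gt[of t] b_lo gamma beta_pos[of t] by (simp add: step_def)
  then have "step t i > search_slack / curvature / \<beta> t"
    using rejected[of i t] armijo_of_small_step[of "step t i" t] Suc by force
  then have "\<gamma> * (search_slack / curvature / \<beta> t) \<le> \<gamma> * step t i"
    using gamma by (intro mult_left_mono) auto
  moreover have "step_const / \<beta> t \<le> \<gamma> * (search_slack / curvature) / \<beta> t"
    using beta_pos[of t] by (intro divide_right_mono) (auto simp: step_const_def)
  ultimately show ?thesis
    by (simp add: step_def Suc mult_ac)
qed

end

section \<open>Decrease of a Lyapunov function\<close>

lemma sum_square_le: "(a + b)\<^sup>2 \<le> 2 * a\<^sup>2 + 2 * b\<^sup>2" for a b :: real
proof -
  have "0 \<le> (a - b)\<^sup>2"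
    by simp
  then show ?thesis
    by (simp add: power2_eq_square algebra_simps)
qed

context oadmm_run
begin

lemma X_decrease:
  "Lagr (X (Suc t)) (y t) (z t) (\<beta> t)
    \<le> Lagr (X t) (y t) (z t) (\<beta> t) - \<delta> * step_const * ((norm (D t))\<^sup>2 / \<beta> t)"
proof -
  have "Lagr (X (Suc t)) (y t) (z t) (\<beta> t) - Lagr (X t) (y t) (z t) (\<beta> t)
      \<le> - \<delta> * step t (j t) * (norm (D t))\<^sup>2"
    using accepted[of t] unfolding armijo_iff X_Suc[symmetric] .
  moreover have "(\<delta> * (norm (D t))\<^sup>2) * (step_const / \<beta> t) \<le> (\<delta> * (norm (D t))\<^sup>2) * step t (j t)"
    using step_lower_bound[of t] delta by (intro mult_left_mono) auto
  ultimately show ?thesis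
    by (simp add: mult_ac)
qed

text \<open>As a function of \<open>y\<close> the Lagrangian is, up to a constant, the objective of the envelope
  problem with center \<open>A X + z / \<beta>\<close>; the modulus \<open>(1 - 1 / \<tau>) / 2\<close> of its growth is at least
  3/8 because \<open>\<tau> \<ge> 4\<close>.\<close>

lemma y_decrease:
  "Lagr (X (Suc t)) (y (Suc t)) (z t) (\<beta> t)
    \<le> Lagr (X (Suc t)) (y t) (z t) (\<beta> t) - 3 / 8 * \<beta> t * (norm (y t - y (Suc t)))\<^sup>2"
proof -
  have S: "S_fun f A (X (Suc t)) w (z t) (\<beta> t)
      = f (X (Suc t)) + \<beta> t / 2 * (norm (w - center t))\<^sup>2 - (norm (z t))\<^sup>2 / (2 * \<beta> t)" for w
  proof -
    define r where "r = A (X (Suc t)) - w"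
    have "norm (w - center t) = norm (r + (1 / \<beta> t) *\<^sub>R z t)"
      using norm_minus_commute[of w "center t"] by (simp add: center_eq r_def algebra_simps)
    moreover have "(norm (r + (1 / \<beta> t) *\<^sub>R z t))\<^sup>2
        = (norm r)\<^sup>2 + 2 / \<beta> t * (z t \<bullet> r) + (norm (z t))\<^sup>2 / (\<beta> t)\<^sup>2"
      unfolding power2_norm_eq_inner
      by (simp add: inner_add_left inner_add_right inner_commute[of r "z t"] power2_eq_square
          add_divide_distrib)
    ultimately have "\<beta> t / 2 * (norm (w - center t))\<^sup>2
        = \<beta> t / 2 * (norm r)\<^sup>2 + z t \<bullet> r + (norm (z t))\<^sup>2 / (2 * \<beta> t)"
      using beta_pos[of t] by (simp add: distrib_left power2_eq_square)
    then show ?thesis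
      unfolding S_fun_def r_def[symmetric] by linarith
  qed
  have "3 / 8 * (\<beta> t * (norm (y t - y (Suc t)))\<^sup>2)
      \<le> (1 - 1 / \<tau>) / 2 * (\<beta> t * (norm (y t - y (Suc t)))\<^sup>2)"
  proof (rule mult_right_mono)
    have "1 / \<tau> \<le> 1 / 4"
      using tau_ge by (intro divide_left_mono) auto
    then show "3 / 8 \<le> (1 - 1 / \<tau>) / 2"
      by simp
  qed (use beta_pos[of t] in auto)
  moreover have "\<beta> t / 2 * (1 - 1 / \<tau>) * (norm (y t - y (Suc t)))\<^sup>2
      = (1 - 1 / \<tau>) / 2 * (\<beta> t * (norm (y t - y (Suc t)))\<^sup>2)"
    by simp
  ultimately show ?thesis
    using y_growth[of t "y t"] unfolding Lagr_def S mult.assoc[of "3 / 8"] by linarith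
qed

lemma z_increase:
  "Lagr (X (Suc t)) (y (Suc t)) (z (Suc t)) (\<beta> t)
    = Lagr (X (Suc t)) (y (Suc t)) (z t) (\<beta> t) + (norm (dz t))\<^sup>2 / (\<sigma> * \<beta> t)"
proof -
  have "z (Suc t) = z t + dz t"
    by (simp add: dz_def)
  moreover have "dz t \<bullet> (A (X (Suc t)) - y (Suc t)) = (norm (dz t))\<^sup>2 / (\<sigma> * \<beta> t)"
    by (simp add: residual_dz power2_norm_eq_inner)
  ultimately show ?thesis
    by (simp add: Lagr_def S_fun_def inner_add_left)
qed

definition penalty_const :: real where
  "penalty_const = 4 * Z\<^sup>2 + C_h\<^sup>2 * \<tau>"

lemma beta_increment_le: "(\<beta> (Suc t) - \<beta> t) / (\<beta> t)\<^sup>2 \<le> 2 * (1 / \<beta> t - 1 / \<beta> (Suc t))"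
proof -
  have 1: "1 / \<beta> t - 1 / \<beta> (Suc t) = (\<beta> (Suc t) - \<beta> t) / (\<beta> t * \<beta> (Suc t))"
    using beta_pos[of t] beta_pos[of "Suc t"] by (simp add: field_simps)
  have 2: "(\<beta> (Suc t) - \<beta> t) / (\<beta> t * (2 * \<beta> t)) \<le> (\<beta> (Suc t) - \<beta> t) / (\<beta> t * \<beta> (Suc t))"
    using beta_pos[of t] beta_pos[of "Suc t"] beta_Suc_le[of t] beta_mono[of t]
    by (intro divide_left_mono mult_left_mono) auto
  have 3: "i / x\<^sup>2 = 2 * (i / (x * (2 * x)))" for i x :: real
    by (simp add: power2_eq_square)
  show ?thesis
    unfolding 1 3[of _ "\<beta> t"] by (rule mult_left_mono[OF 2]) simp
qed

text \<open>Raising the penalty costs little: the residual is of order \<open>1 / \<beta>\<close> because the multipliers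
  are bounded, and the Moreau envelope moves by the change of \<open>\<tau> / \<beta>\<close> times the squared
  envelope gradient. Both costs telescope.\<close>

lemma beta_increase:
  "Lagr (X (Suc t)) (y (Suc t)) (z (Suc t)) (\<beta> (Suc t))
    \<le> Lagr (X (Suc t)) (y (Suc t)) (z (Suc t)) (\<beta> t)
      + penalty_const * (1 / \<beta> t - 1 / \<beta> (Suc t))"
proof -
  define inc where "inc = \<beta> (Suc t) - \<beta> t"
  define r where "r = A (X (Suc t)) - y (Suc t)"
  have inc: "inc \<ge> 0" "\<beta> (Suc t) = \<beta> t + inc"
    using beta_mono[of t] by (auto simp: inc_def)
  have inc2: "inc / (\<beta> t)\<^sup>2 \<le> 2 * (1 / \<beta> t - 1 / \<beta> (Suc t))"
    unfolding inc_def by (rule beta_increment_le)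
  have "(norm r)\<^sup>2 \<le> (2 * Z / \<beta> t)\<^sup>2"
    unfolding r_def using norm_residual by (rule power_mono) simp
  then have "inc / 2 * (norm r)\<^sup>2 \<le> inc / 2 * (2 * Z / \<beta> t)\<^sup>2"
    using inc by (intro mult_left_mono) auto
  also have "\<dots> = 2 * Z\<^sup>2 * (inc / (\<beta> t)\<^sup>2)"
    by (simp add: power_divide power_mult_distrib)
  also have "\<dots> \<le> 2 * Z\<^sup>2 * (2 * (1 / \<beta> t - 1 / \<beta> (Suc t)))"
    using inc2 by (intro mult_left_mono) auto
  finally have res: "inc / 2 * (norm r)\<^sup>2 \<le> 4 * Z\<^sup>2 * (1 / \<beta> t - 1 / \<beta> (Suc t))"
    by (simp add: algebra_simps)
  define n where "n = (norm (env_grad t))\<^sup>2"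
  have n: "0 \<le> n" "n \<le> C_h\<^sup>2"
    using norm_env_grad[of t] unfolding n_def by (auto intro: power_mono)
  have "norm (yb (Suc t) - y (Suc t)) = \<tau> / \<beta> t * norm (env_grad t)"
    using beta_pos[of t] tau_ge by (simp add: y_eq_yb)
  then have dist: "(norm (yb (Suc t) - y (Suc t)))\<^sup>2 = (\<tau> / \<beta> t)\<^sup>2 * n"
    by (simp add: n_def power_mult_distrib power_divide)
  have "moreau_env h (\<tau> / \<beta> (Suc t)) (y (Suc t))
      \<le> h (yb (Suc t)) + 1 / (2 * (\<tau> / \<beta> (Suc t))) * ((\<tau> / \<beta> t)\<^sup>2 * n)"
    unfolding dist[symmetric]
    using tau_ge beta_pos[of "Suc t"] by (intro moreau_env_le[OF h_lipschitz]) auto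
  also have "1 / (2 * (\<tau> / \<beta> (Suc t))) * ((\<tau> / \<beta> t)\<^sup>2 * n)
      = \<tau> / (2 * \<beta> t) * n + \<tau> / 2 * n * (inc / (\<beta> t)\<^sup>2)"
    unfolding inc(2) using tau_ge beta_pos[of t] by (simp add: power2_eq_square field_simps)
  also have "\<tau> / 2 * n * (inc / (\<beta> t)\<^sup>2) \<le> \<tau> / 2 * C_h\<^sup>2 * (2 * (1 / \<beta> t - 1 / \<beta> (Suc t)))"
    using n inc2 inc tau_ge beta_pos[of t] by (intro mult_mono mult_left_mono) auto
  finally have env: "moreau_env h (\<tau> / \<beta> (Suc t)) (y (Suc t)) \<le> moreau_env h (\<tau> / \<beta> t) (y (Suc t))
      + C_h\<^sup>2 * \<tau> * (1 / \<beta> t - 1 / \<beta> (Suc t))"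
    unfolding env_value n_def[symmetric] by (simp add: algebra_simps)
  have "\<beta> (Suc t) / 2 * (norm r)\<^sup>2 = \<beta> t / 2 * (norm r)\<^sup>2 + inc / 2 * (norm r)\<^sup>2"
    unfolding inc(2) by (simp add: add_divide_distrib distrib_right)
  then have "S_fun f A (X (Suc t)) (y (Suc t)) (z (Suc t)) (\<beta> (Suc t))
      = S_fun f A (X (Suc t)) (y (Suc t)) (z (Suc t)) (\<beta> t) + inc / 2 * (norm r)\<^sup>2"
    by (simp add: S_fun_def r_def[symmetric])
  moreover have "penalty_const * (1 / \<beta> t - 1 / \<beta> (Suc t))
      = 4 * Z\<^sup>2 * (1 / \<beta> t - 1 / \<beta> (Suc t)) + C_h\<^sup>2 * \<tau> * (1 / \<beta> t - 1 / \<beta> (Suc t))"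
    unfolding penalty_const_def by (rule distrib_right)
  ultimately show ?thesis
    using res env unfolding Lagr_def by linarith
qed

text \<open>The weight of the memory term \<open>(norm (dz t))\<^sup>2 / \<beta> t\<close> in the Lyapunov function, and that of
  the drift of the envelope gradient caused by the change of \<open>\<tau> / \<beta>\<close>.\<close>

definition memory_const :: real where
  "memory_const = 5 * (\<sigma> - 1) / (4 * \<sigma> * (2 - \<sigma>))"

definition drift_const :: real where
  "drift_const = 5 / 2 * \<sigma> / (2 - \<sigma>)\<^sup>2 * C_h\<^sup>2"

lemma norm_env_grad_diff:
  "norm (env_grad (Suc t) - env_grad t)
    \<le> \<beta> (Suc t) / \<tau> * norm (y (Suc t) - y (Suc (Suc t))) + (\<beta> (Suc t) / \<beta> t - 1) * C_h"
proof -
  define \<mu> where "\<mu> = \<tau> / \<beta> (Suc t)"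
  define \<nu> where "\<nu> = \<tau> / \<beta> t"
  have \<mu>: "\<mu> > 0"
    using tau_ge beta_pos[of "Suc t"] by (simp add: \<mu>_def)
  have "2 * W_h * \<mu> \<le> 1"
    using beta_weak_convexity[of "Suc t"] beta_pos[of "Suc t"] by (simp add: \<mu>_def mult_ac)
  from envelope_gradient_difference[OF h_lipschitz h_weakly_convex W_h_nonneg
      env_grad_subgradient[of "Suc t"] env_grad_subgradient[of t]
      y_eq_yb[of "Suc t", folded \<mu>_def] y_eq_yb[of t, folded \<nu>_def] \<mu> this]
  have "\<mu> * norm (env_grad (Suc t) - env_grad t)
      \<le> norm (y (Suc (Suc t)) - y (Suc t)) + \<bar>\<mu> - \<nu>\<bar> * C_h" .
  moreover have "\<bar>\<mu> - \<nu>\<bar> = \<mu> * (\<beta> (Suc t) / \<beta> t - 1)"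
  proof -
    have "\<mu> \<le> \<nu>"
      unfolding \<mu>_def \<nu>_def using tau_ge beta_pos[of t] beta_pos[of "Suc t"] beta_mono[of t]
      by (intro divide_left_mono) auto
    moreover have "\<mu> * (\<beta> (Suc t) / \<beta> t) = \<nu>"
      unfolding \<mu>_def \<nu>_def using beta_pos[of t] beta_pos[of "Suc t"] by simp
    ultimately show ?thesis
      by (simp add: right_diff_distrib)
  qed
  ultimately have "norm (env_grad (Suc t) - env_grad t)
      \<le> (norm (y (Suc (Suc t)) - y (Suc t)) + \<mu> * (\<beta> (Suc t) / \<beta> t - 1) * C_h) / \<mu>"
    using \<mu> by (simp add: pos_le_divide_eq mult.commute)
  also have "\<dots> = norm (y (Suc (Suc t)) - y (Suc t)) / \<mu> + (\<beta> (Suc t) / \<beta> t - 1) * C_h"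
    using \<mu> by (simp add: add_divide_distrib)
  finally show ?thesis
    by (simp add: \<mu>_def norm_minus_commute mult.commute)
qed

text \<open>Convexity of the square, with the weights \<open>\<sigma> - 1\<close> and \<open>2 - \<sigma>\<close> summing to 1.\<close>

lemma norm_dz_Suc_sq:
  "(2 - \<sigma>) * (norm (dz (Suc t)))\<^sup>2 \<le> (\<sigma> - 1) * ((norm (dz t))\<^sup>2 - (norm (dz (Suc t)))\<^sup>2)
    + \<sigma>\<^sup>2 / (2 - \<sigma>) * (norm (env_grad (Suc t) - env_grad t))\<^sup>2"
proof -
  define a where "a = norm (dz t)"
  define q where "q = norm (env_grad (Suc t) - env_grad t)"
  define w where "w = 2 - \<sigma>"
  have w: "w > 0" "\<sigma> - 1 = 1 - w" "1 - w \<ge> 0"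
    using sigma by (auto simp: w_def)
  have "norm (dz (Suc t)) \<le> norm ((1 - \<sigma>) *\<^sub>R dz t) + norm (\<sigma> *\<^sub>R (env_grad (Suc t) - env_grad t))"
    unfolding dz_Suc by (rule norm_triangle_ineq)
  also have "\<dots> = (1 - w) * a + w * (\<sigma> / w * q)"
    using sigma w by (simp add: a_def q_def)
  finally have "(norm (dz (Suc t)))\<^sup>2 \<le> ((1 - w) * a + w * (\<sigma> / w * q))\<^sup>2"
    by (rule power_mono) simp
  also have "\<dots> \<le> (1 - w) * a\<^sup>2 + w * (\<sigma> / w * q)\<^sup>2"
  proof -
    have "w * (1 - w) * (a - c)\<^sup>2 = (1 - w) * a\<^sup>2 + w * c\<^sup>2 - ((1 - w) * a + w * c)\<^sup>2" for c
      by (simp add: power2_eq_square algebra_simps)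
    moreover have "0 \<le> w * (1 - w) * (a - \<sigma> / w * q)\<^sup>2"
      using w by simp
    ultimately show ?thesis
      by simp
  qed
  also have "w * (\<sigma> / w * q)\<^sup>2 = \<sigma>\<^sup>2 / w * q\<^sup>2"
    using w by (simp add: power2_eq_square)
  finally show ?thesis
    unfolding w(2) w_def[symmetric] a_def[symmetric] q_def[symmetric] by (simp add: algebra_simps)
qed

text \<open>The relative increment of \<open>\<beta>\<close> is at most 1, so its square is bounded by the increment
  itself, which telescopes after division by \<open>\<beta>\<close>.\<close>

lemma beta_ratio_sq_le: "(\<beta> (Suc t) / \<beta> t - 1)\<^sup>2 / \<beta> (Suc t) \<le> 1 / \<beta> t - 1 / \<beta> (Suc t)"
proof -
  define e where "e = \<beta> (Suc t) / \<beta> t - 1"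
  have e: "0 \<le> e" "e \<le> 1"
    using beta_pos[of t] beta_mono[of t] beta_Suc_le[of t] by (auto simp: e_def pos_divide_le_eq)
  have "e\<^sup>2 / \<beta> (Suc t) \<le> e / \<beta> (Suc t)"
    using e beta_pos[of "Suc t"] by (intro divide_right_mono) (auto simp: power2_eq_square mult_left_le)
  also have "\<dots> = 1 / \<beta> t - 1 / \<beta> (Suc t)"
    using beta_pos[of t] beta_pos[of "Suc t"] by (simp add: e_def field_simps)
  finally show ?thesis
    by (simp add: e_def)
qed

text \<open>The recursion \<open>dz (Suc t) = (1 - \<sigma>) *\<^sub>R dz t + \<sigma> *\<^sub>R \<dots>\<close> bounds the ascent caused by the
  multiplier by a telescoping memory term and the change of the envelope gradient. The latter
  is controlled by the \<open>y\<close>-step, and \<open>\<tau> * (2 - \<sigma>) \<ge> 4\<close> makes its coefficient smaller than the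
  3/8 gained there. The factor 5/4 on the left leaves a quarter of the ascent to spare.\<close>

lemma dz_memory:
  "5 / 4 * ((norm (dz (Suc t)))\<^sup>2 / (\<sigma> * \<beta> (Suc t)))
    \<le> memory_const * ((norm (dz t))\<^sup>2 / \<beta> t - (norm (dz (Suc t)))\<^sup>2 / \<beta> (Suc t))
      + 5 / 16 * \<beta> (Suc t) * (norm (y (Suc t) - y (Suc (Suc t))))\<^sup>2
      + drift_const * (1 / \<beta> t - 1 / \<beta> (Suc t))"
proof -
  define w where "w = 2 - \<sigma>"
  define B where "B = \<beta> (Suc t)"
  define a where "a = (norm (dz t))\<^sup>2"
  define a' where "a' = (norm (dz (Suc t)))\<^sup>2"
  define q where "q = (norm (env_grad (Suc t) - env_grad t))\<^sup>2"
  define n where "n = (norm (y (Suc t) - y (Suc (Suc t))))\<^sup>2"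
  define e where "e = \<beta> (Suc t) / \<beta> t - 1"
  have pos: "w > 0" "B > 0" "\<sigma> > 0" "\<tau> > 0"
    using sigma beta_pos[of "Suc t"] tau_ge by (auto simp: w_def B_def)
  \<comment> \<open>The factor that turns \<open>w * a'\<close> in the recursion for \<open>dz\<close> into the left side of the claim.\<close>
  define k where "k = 5 / (4 * \<sigma> * w * B)"
  have k: "k > 0"
    using pos by (simp add: k_def)
  have "w * a' \<le> (\<sigma> - 1) * (a - a') + \<sigma>\<^sup>2 / w * q"
    using norm_dz_Suc_sq[of t] by (simp add: w_def a_def a'_def q_def)
  then have "k * (w * a') \<le> k * ((\<sigma> - 1) * (a - a') + \<sigma>\<^sup>2 / w * q)"
    using k by (intro mult_left_mono) auto
  moreover have "k * (w * a') = 5 / 4 * (a' / (\<sigma> * B))"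
    using pos by (simp add: k_def)
  moreover have "k * ((\<sigma> - 1) * (a - a')) = memory_const * (a / B - a' / B)"
    using pos by (simp add: k_def memory_const_def w_def[symmetric] diff_divide_distrib[symmetric])
  moreover have "k * (\<sigma>\<^sup>2 / w * q) = 5 * \<sigma> / (4 * w\<^sup>2 * B) * q"
    using pos by (simp add: k_def power2_eq_square mult_ac)
  ultimately have 1: "5 / 4 * (a' / (\<sigma> * B))
      \<le> memory_const * (a / B - a' / B) + 5 * \<sigma> / (4 * w\<^sup>2 * B) * q"
    by (simp add: distrib_left)
  have "a / B \<le> a / \<beta> t"
    using beta_mono[of t] beta_pos[of t] by (intro divide_left_mono) (auto simp: a_def B_def)
  then have 2: "memory_const * (a / B - a' / B) \<le> memory_const * (a / \<beta> t - a' / B)"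
    using sigma by (intro mult_left_mono) (auto simp: memory_const_def)
  have "q \<le> (B / \<tau> * norm (y (Suc t) - y (Suc (Suc t))) + e * C_h)\<^sup>2"
    unfolding q_def B_def e_def using norm_env_grad_diff by (rule power_mono) simp
  also have "\<dots> \<le> 2 * (B / \<tau>)\<^sup>2 * n + 2 * C_h\<^sup>2 * e\<^sup>2"
    using sum_square_le[of "B / \<tau> * norm (y (Suc t) - y (Suc (Suc t)))" "e * C_h"]
    by (simp add: n_def power_mult_distrib power_divide mult_ac)
  finally have "5 * \<sigma> / (4 * w\<^sup>2 * B) * q \<le> 5 * \<sigma> / (4 * w\<^sup>2 * B) * (2 * (B / \<tau>)\<^sup>2 * n + 2 * C_h\<^sup>2 * e\<^sup>2)"
    using pos by (intro mult_left_mono) auto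
  also have "\<dots> = 5 / 2 * \<sigma> / (\<tau> * w)\<^sup>2 * (B * n) + drift_const * (e\<^sup>2 / B)"
    using pos by (simp add: drift_const_def w_def[symmetric] power2_eq_square distrib_left mult_ac)
  also have "5 / 2 * \<sigma> / (\<tau> * w)\<^sup>2 * (B * n) \<le> 5 / 16 * (B * n)"
  proof (rule mult_right_mono)
    have "4\<^sup>2 \<le> (\<tau> * w)\<^sup>2"
      using tau_sigma unfolding w_def by (rule power_mono) simp
    then have "5 / 2 * \<sigma> / (\<tau> * w)\<^sup>2 \<le> 5 / 2 * 2 / 4\<^sup>2"
      using sigma by (intro frac_le) auto
    then show "5 / 2 * \<sigma> / (\<tau> * w)\<^sup>2 \<le> 5 / 16"
      by simp
  qed (use pos in \<open>auto simp: n_def\<close>)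
  also have "drift_const * (e\<^sup>2 / B) \<le> drift_const * (1 / \<beta> t - 1 / B)"
    unfolding e_def B_def using beta_ratio_sq_le[of t] sigma
    by (intro mult_left_mono) (auto simp: drift_const_def)
  finally have 3: "5 * \<sigma> / (4 * w\<^sup>2 * B) * q \<le> 5 / 16 * (B * n) + drift_const * (1 / \<beta> t - 1 / B)"
    by simp
  have "5 / 4 * (a' / (\<sigma> * B)) \<le> memory_const * (a / \<beta> t - a' / B) + 5 / 16 * (B * n)
      + drift_const * (1 / \<beta> t - 1 / B)"
    using 1 2 3 by linarith
  then show ?thesis
    unfolding a_def a'_def B_def n_def by (simp add: mult.assoc)
qed

text \<open>The second term stores what \<open>dz_memory\<close> needs from the previous iteration; the last two
  count down the telescoping costs of the growing penalty.\<close>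

definition potential :: "nat \<Rightarrow> real" where
  "potential t = Lagr (X (Suc t)) (y (Suc t)) (z (Suc t)) (\<beta> (Suc t))
    + memory_const * ((norm (dz t))\<^sup>2 / \<beta> t) + penalty_const / \<beta> (Suc t) + drift_const / \<beta> t"

lemma potential_decrease:
  "potential (Suc t) \<le> potential t - \<delta> * step_const * ((norm (D (Suc t)))\<^sup>2 / \<beta> (Suc t))
    - 1 / 8 * ((norm (dz (Suc t)))\<^sup>2 / \<beta> (Suc t))"
proof -
  have "1 / 8 * ((norm (dz (Suc t)))\<^sup>2 / \<beta> (Suc t)) \<le> 1 / 4 * ((norm (dz (Suc t)))\<^sup>2 / (\<sigma> * \<beta> (Suc t)))"
  proof -
    have "(norm (dz (Suc t)))\<^sup>2 / (2 * \<beta> (Suc t)) \<le> (norm (dz (Suc t)))\<^sup>2 / (\<sigma> * \<beta> (Suc t))"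
      using sigma beta_pos[of "Suc t"] by (intro divide_left_mono mult_right_mono) auto
    then show ?thesis
      by simp
  qed
  moreover have "5 / 16 * \<beta> (Suc t) * (norm (y (Suc t) - y (Suc (Suc t))))\<^sup>2
      \<le> 3 / 8 * \<beta> (Suc t) * (norm (y (Suc t) - y (Suc (Suc t))))\<^sup>2"
    using beta_pos[of "Suc t"] by (intro mult_right_mono) auto
  ultimately show ?thesis
    using X_decrease[of "Suc t"] y_decrease[of "Suc t"] z_increase[of "Suc t"]
      beta_increase[of "Suc t"] dz_memory[of t]
    unfolding potential_def right_diff_distrib by simp
qed

text \<open>The matrices \<open>X t\<close> stay in a ball, the multipliers are bounded and the residuals tend
  to 0, so every term of the Lagrangian is bounded below; the envelope is
  close to \<open>h\<close>, which is Lipschitz.\<close>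

lemma potential_bounded_below: "\<exists>m. \<forall>t. m \<le> potential t"
proof -
  define N where "N = norm (mat 1 :: real ^ 'a ^ 'a)"
  have X_norm: "norm (X t) \<le> N" for t
    using stiefel_norm_sq[OF X_stiefel[of t]] by (simp add: N_def)
  have cont: "continuous_on (cball 0 N) f"
    using f_diff by (intro continuous_at_imp_continuous_on) (auto intro: differentiable_imp_continuous_within)
  have "N \<ge> 0"
    by (simp add: N_def)
  then have "cball 0 N \<noteq> ({} :: (real ^ 'a ^ 'b) set)"
    by simp
  then obtain U where U: "\<And>U'. U' \<in> cball 0 N \<Longrightarrow> f U \<le> f U'"
    using continuous_attains_inf[OF compact_cball _ cont] by blast
  define q where "q = 2 * Z / \<beta>0"
  have q: "norm (A (X (Suc t)) - y (Suc t)) \<le> q" for t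
  proof -
    have "2 * Z / \<beta> t \<le> q"
      unfolding q_def using Z_nonneg beta_ge[of t] beta0 by (intro divide_left_mono) auto
    then show ?thesis
      using norm_residual[of t] by linarith
  qed
  have C_g: "C_g \<ge> 0"
    using g_lipschitz by (rule lipschitz_on_nonneg)
  define m where "m = f U - Z * q - (g 0 + C_g * N) + (h 0 - C_h * (A_norm * N + q)) - C_h\<^sup>2 * (\<tau> / \<beta>0) / 2"
  have "m \<le> potential t" for t
  proof -
    let ?X = "X (Suc t)" and ?y = "y (Suc t)" and ?z = "z (Suc t)" and ?b = "\<beta> (Suc t)"
    have "f U \<le> f ?X"
      using U X_norm by simp
    moreover have "- (Z * q) \<le> ?z \<bullet> (A ?X - ?y)"
    proof -
      have "\<bar>?z \<bullet> (A ?X - ?y)\<bar> \<le> norm ?z * norm (A ?X - ?y)"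
        by (rule Cauchy_Schwarz_ineq2)
      also have "\<dots> \<le> Z * q"
        using norm_z q Z_nonneg by (intro mult_mono) auto
      finally show ?thesis
        by linarith
    qed
    moreover have "0 \<le> ?b / 2 * (norm (A ?X - ?y))\<^sup>2"
      using beta_pos[of "Suc t"] by simp
    moreover have "g ?X \<le> g 0 + C_g * N"
    proof -
      have "g ?X - g 0 \<le> C_g * norm ?X"
        using lipschitz_onD[OF g_lipschitz, of ?X 0] by (simp add: dist_norm)
      also have "\<dots> \<le> C_g * N"
        using X_norm C_g by (intro mult_left_mono)
      finally show ?thesis
        by simp
    qed
    moreover have "h 0 - C_h * (A_norm * N + q) \<le> h ?y"
    proof -
      have "norm ?y \<le> norm (A ?X) + norm (A ?X - ?y)"
        using norm_triangle_ineq4[of "A ?X" "A ?X - ?y"] by simp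
      also have "\<dots> \<le> A_norm * N + q"
        using norm_A[of ?X] mult_left_mono[OF X_norm[of "Suc t"] A_norm_nonneg] q[of t] by linarith
      finally have "C_h * norm ?y \<le> C_h * (A_norm * N + q)"
        using C_h_nonneg by (rule mult_left_mono)
      moreover have "h 0 - h ?y \<le> C_h * norm ?y"
        using lipschitz_onD[OF h_lipschitz, of 0 ?y] by (simp add: dist_norm)
      ultimately show ?thesis
        by linarith
    qed
    moreover have "h ?y - C_h\<^sup>2 * (\<tau> / \<beta>0) / 2 \<le> moreau_env h (\<tau> / ?b) ?y"
    proof -
      have "\<tau> / ?b \<le> \<tau> / \<beta>0"
        using beta_ge[of "Suc t"] beta0 tau_ge by (intro divide_left_mono) auto
      then have "C_h\<^sup>2 * (\<tau> / ?b) / 2 \<le> C_h\<^sup>2 * (\<tau> / \<beta>0) / 2"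
        by (intro divide_right_mono mult_left_mono) auto
      moreover have "h ?y - C_h\<^sup>2 * (\<tau> / ?b) / 2 \<le> moreau_env h (\<tau> / ?b) ?y"
        using tau_ge beta_pos[of "Suc t"] by (intro moreau_env_lower_bound[OF h_lipschitz]) auto
      ultimately show ?thesis
        by linarith
    qed
    moreover have "0 \<le> memory_const * ((norm (dz t))\<^sup>2 / \<beta> t)" "0 \<le> penalty_const / ?b"
      "0 \<le> drift_const / \<beta> t"
      using sigma tau_ge beta_pos[of t] beta_pos[of "Suc t"]
      by (auto simp: memory_const_def penalty_const_def drift_const_def)
    ultimately show ?thesis
      unfolding m_def potential_def Lagr_def S_fun_def by linarith
  qed
  then show ?thesis
    by blast
qed

lemma energy_bound:
  "\<exists>E. \<forall>T. (\<Sum>t = 1..T. (norm (D t))\<^sup>2 / \<beta> t) \<le> E \<and> (\<Sum>t = 1..T. (norm (dz t))\<^sup>2 / \<beta> t) \<le> E"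
proof -
  obtain m where m: "\<And>t. m \<le> potential t"
    using potential_bounded_below by blast
  define d where "d t = (norm (D t))\<^sup>2 / \<beta> t" for t
  define a where "a t = (norm (dz t))\<^sup>2 / \<beta> t" for t
  have nonneg: "0 \<le> d t" "0 \<le> a t" for t
    using beta_pos[of t] by (auto simp: d_def a_def)
  have tele: "\<delta> * step_const * (\<Sum>t = 1..T. d t) + 1 / 8 * (\<Sum>t = 1..T. a t) \<le> potential 0 - potential T" for T
  proof (induction T)
    case 0
    show ?case
      by simp
  next
    case (Suc T)
    then show ?case
      using potential_decrease[of T, folded d_def a_def] by (simp add: distrib_left)
  qed
  define c where "c = \<delta> * step_const"
  have c: "c > 0"
    using delta step_const_pos by (simp add: c_def)
  define P where "P = potential 0 - m"
  have "(\<Sum>t = 1..T. d t) \<le> max (P / c) (8 * P)" "(\<Sum>t = 1..T. a t) \<le> max (P / c) (8 * P)" for T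
  proof -
    have *: "c * (\<Sum>t = 1..T. d t) + 1 / 8 * (\<Sum>t = 1..T. a t) \<le> P"
      using tele[of T] m[of T] by (simp add: c_def P_def)
    have **: "0 \<le> (\<Sum>t = 1..T. d t)" "0 \<le> (\<Sum>t = 1..T. a t)"
      using nonneg by (auto intro: sum_nonneg)
    then have "c * (\<Sum>t = 1..T. d t) \<le> P"
      using * by linarith
    then have "(\<Sum>t = 1..T. d t) \<le> P / c"
      using c by (simp add: pos_le_divide_eq mult.commute)
    then show "(\<Sum>t = 1..T. d t) \<le> max (P / c) (8 * P)"
      by simp
    have "0 \<le> c * (\<Sum>t = 1..T. d t)"
      using c ** by simp
    then have "(\<Sum>t = 1..T. a t) \<le> 8 * P"
      using * by linarith
    then show "(\<Sum>t = 1..T. a t) \<le> max (P / c) (8 * P)"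
      by simp
  qed
  then show ?thesis
    unfolding d_def a_def by blast
qed

end

section \<open>Convergence rate\<close>

context oadmm_run
begin

text \<open>Each part of the measure is witnessed by an iterate of the method: \<open>env_grad t\<close> is a
  subgradient of \<open>h\<close> at \<open>yb (Suc t)\<close> and differs from \<open>z (Suc t)\<close> by a multiple of \<open>dz t\<close>, and
  the next search direction is computed from a subgradient of \<open>g\<close> at \<open>X (Suc t)\<close>.\<close>

lemma Crit_le:
  "Crit f g h A (X (Suc t)) (yb (Suc t)) (z (Suc t))
    \<le> (2 * Z + \<tau> * C_h) / \<beta> t + (1 + 2 * A_norm) * norm (dz t)
      + max 1 (1 / (2 * \<rho>)) * norm (D (Suc t))"
proof -
  let ?X = "X (Suc t)" and ?z = "z (Suc t)"
  have feas: "norm (A ?X - yb (Suc t)) \<le> (2 * Z + \<tau> * C_h) / \<beta> t"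
  proof -
    have "norm (A ?X - yb (Suc t)) = norm ((A ?X - y (Suc t)) + (\<tau> / \<beta> t) *\<^sub>R env_grad t)"
      using y_eq_yb[of t] by simp
    also have "\<dots> \<le> norm (A ?X - y (Suc t)) + norm ((\<tau> / \<beta> t) *\<^sub>R env_grad t)"
      by (rule norm_triangle_ineq)
    also have "\<dots> \<le> 2 * Z / \<beta> t + \<tau> / \<beta> t * C_h"
      using norm_residual[of t] norm_env_grad[of t] beta_pos[of t] tau_ge
      by (intro add_mono) (simp_all add: mult_left_mono divide_right_mono)
    also have "\<dots> = (2 * Z + \<tau> * C_h) / \<beta> t"
      by (simp add: add_divide_distrib)
    finally show ?thesis .
  qed
  have h_part: "set_norm ((\<lambda>v. v - ?z) ` limiting_subdiff h (yb (Suc t))) \<le> norm (dz t)"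
  proof -
    have "env_grad t \<in> limiting_subdiff h (yb (Suc t))"
      using env_grad_subgradient frechet_subdiff_subset_limiting_subdiff by blast
    then have "set_norm ((\<lambda>v. v - ?z) ` limiting_subdiff h (yb (Suc t))) \<le> norm (env_grad t - ?z)"
      by (intro set_norm_le) blast
    also have "env_grad t - ?z = (1 / \<sigma> - 1) *\<^sub>R dz t"
    proof -
      have "(1 / \<sigma>) *\<^sub>R dz t = env_grad t - z t"
        using dz_env_grad[of t] sigma by simp
      then show ?thesis
        by (simp add: scaleR_diff_left dz_def)
    qed
    also have "norm \<dots> = (1 - 1 / \<sigma>) * norm (dz t)"
      using sigma by simp
    also have "\<dots> \<le> 1 * norm (dz t)"
      using sigma by (intro mult_right_mono) auto
    finally show ?thesis
      by simp
  qed
  define r where "r = \<beta> (Suc t) *\<^sub>R (A ?X - y (Suc t))"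
  have norm_r: "norm r \<le> 2 * norm (dz t)"
  proof -
    have "norm r = \<beta> (Suc t) / (\<sigma> * \<beta> t) * norm (dz t)"
      using beta_pos[of t] beta_pos[of "Suc t"] sigma by (simp add: r_def residual_dz)
    also have "\<dots> \<le> (2 * \<beta> t) / (1 * \<beta> t) * norm (dz t)"
      using beta_pos[of t] beta_Suc_le[of t] sigma
      by (intro mult_right_mono[OF frac_le] mult_right_mono) auto
    finally show ?thesis
      using beta_pos[of t] by simp
  qed
  have g_part: "set_norm ((\<lambda>v. proj_tangent ?X (grad f ?X - v + adjoint A ?z)) ` limiting_subdiff g ?X)
      \<le> max 1 (1 / (2 * \<rho>)) * norm (D (Suc t)) + A_norm * (2 * norm (dz t))"
  proof -
    have "set_norm ((\<lambda>v. proj_tangent ?X (grad f ?X - v + adjoint A ?z)) ` limiting_subdiff g ?X)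
        \<le> norm (proj_tangent ?X (grad f ?X - V (Suc t) + adjoint A ?z))"
      using V_subgrad[of "Suc t"] by (intro set_norm_le) blast
    also have "grad f ?X - V (Suc t) + adjoint A ?z = G (Suc t) - adjoint A r"
      by (simp add: G_eq r_def adjoint_A_add)
    also have "norm (proj_tangent ?X (G (Suc t) - adjoint A r))
        \<le> norm (proj_tangent ?X (G (Suc t))) + norm (proj_tangent ?X (adjoint A r))"
      unfolding proj_tangent_diff by (rule norm_triangle_ineq4)
    also have "\<dots> \<le> max 1 (1 / (2 * \<rho>)) * norm (D (Suc t)) + A_norm * (2 * norm (dz t))"
    proof (rule add_mono)
      show "norm (proj_tangent ?X (G (Suc t))) \<le> max 1 (1 / (2 * \<rho>)) * norm (D (Suc t))"
        unfolding D_def by (rule norm_proj_tangent_le_G_rho[OF X_stiefel rho])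
      have "norm (proj_tangent ?X (adjoint A r)) \<le> norm (adjoint A r)"
        by (rule norm_proj_tangent_le[OF X_stiefel])
      also have "\<dots> \<le> A_norm * norm r"
        by (rule norm_adjoint_A)
      also have "\<dots> \<le> A_norm * (2 * norm (dz t))"
        using norm_r A_norm_nonneg by (rule mult_left_mono)
      finally show "norm (proj_tangent ?X (adjoint A r)) \<le> A_norm * (2 * norm (dz t))" .
    qed
    finally show ?thesis .
  qed
  show ?thesis
    using feas h_part g_part unfolding Crit_def by (simp add: distrib_right)
qed

lemma average_Crit_le:
  "\<exists>C1\<ge>0. \<exists>C2\<ge>0. \<forall>T\<ge>1.
    1 / real T * (\<Sum>t = 1..T. Crit f g h A (X (t + 1)) (yb (t + 1)) (z (t + 1)))
      \<le> C1 * real T powr ((p - 1) / 2) + C2 * real T powr (- p)"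
proof -
  obtain E where E: "\<And>T. (\<Sum>t = 1..T. (norm (D t))\<^sup>2 / \<beta> t) \<le> E"
    "\<And>T. (\<Sum>t = 1..T. (norm (dz t))\<^sup>2 / \<beta> t) \<le> E"
    using energy_bound by blast
  have E_nonneg: "E \<ge> 0"
    using E(1)[of 0] by simp
  define a where "a = 2 * Z + \<tau> * C_h"
  define b' where "b' = 1 + 2 * A_norm"
  define c where "c = max 1 (1 / (2 * \<rho>))"
  \<comment> \<open>\<open>\<beta> t \<le> 2 * \<beta>0 * T powr p\<close>; the weights \<open>\<beta> (Suc t)\<close> of the search directions may be
    twice as large.\<close>
  define C1 where "C1 = b' * ((E + 2 * \<beta>0) / 2) + c * ((E + 4 * \<beta>0) / 2)"
  define C2 where "C2 = a / (\<beta>0 * \<xi>) / (1 - p)"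
  have nonneg: "a \<ge> 0" "b' \<ge> 0" "c \<ge> 0"
    using Z_nonneg C_h_nonneg tau_ge A_norm_nonneg by (auto simp: a_def b'_def c_def)
  have C: "C1 \<ge> 0" "C2 \<ge> 0"
    using nonneg E_nonneg beta0 xi p by (auto simp: C1_def C2_def)
  have "1 / real T * (\<Sum>t = 1..T. Crit f g h A (X (t + 1)) (yb (t + 1)) (z (t + 1)))
      \<le> C1 * real T powr ((p - 1) / 2) + C2 * real T powr (- p)" if T: "1 \<le> T" for T
  proof -
    have "(\<Sum>t = 1..T. Crit f g h A (X (t + 1)) (yb (t + 1)) (z (t + 1)))
        \<le> (\<Sum>t = 1..T. a / \<beta> t + b' * norm (dz t) + c * norm (D (Suc t)))"
      unfolding a_def b'_def c_def using Crit_le by (intro sum_mono) simp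
    also have "\<dots> = (\<Sum>t = 1..T. a / \<beta> t) + b' * (\<Sum>t = 1..T. norm (dz t))
        + c * (\<Sum>t = 1..T. norm (D (Suc t)))"
      by (simp add: sum.distrib sum_distrib_left)
    also have "\<dots> \<le> C2 * real T powr (1 - p) + b' * ((E + 2 * \<beta>0) / 2 * real T powr ((1 + p) / 2))
        + c * ((E + 4 * \<beta>0) / 2 * real T powr ((1 + p) / 2))"
    proof (intro add_mono mult_left_mono nonneg)
      have beta_upper: "\<beta> t \<le> 2 * \<beta>0 * real T powr p" if "t \<le> T" for t
        unfolding \<beta>_def using beta0 xi p that T by (intro beta_seq_upper) auto
      have "(\<Sum>t = 1..T. a / \<beta> t) \<le> (\<Sum>t = 1..T. a / (\<beta>0 * \<xi>) * real t powr - p)"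
      proof (rule sum_mono)
        fix t assume t: "t \<in> {1..T}"
        have "a / \<beta> t \<le> a / (\<beta>0 * \<xi> * real t powr p)"
          using nonneg beta0 xi t beta_pos[of t] beta_seq_lower[of \<beta>0 \<xi> t p, folded \<beta>_def]
          by (intro divide_left_mono) auto
        then show "a / \<beta> t \<le> a / (\<beta>0 * \<xi>) * real t powr - p"
          by (simp add: powr_minus divide_inverse mult_ac)
      qed
      also have "\<dots> = a / (\<beta>0 * \<xi>) * (\<Sum>t = 1..T. real t powr - p)"
        by (simp add: sum_distrib_left)
      also have "\<dots> \<le> a / (\<beta>0 * \<xi>) * (real T powr (1 - p) / (1 - p))"
        using nonneg beta0 xi by (intro mult_left_mono sum_powr_minus_le p) auto
      finally show "(\<Sum>t = 1..T. a / \<beta> t) \<le> C2 * real T powr (1 - p)"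
        by (simp add: C2_def)
      show "(\<Sum>t = 1..T. norm (dz t)) \<le> (E + 2 * \<beta>0) / 2 * real T powr ((1 + p) / 2)"
        by (rule sum_le_of_weighted_squares[OF T _ _ E(2)]) (auto simp: beta_pos beta_upper)
      have "(\<Sum>t = 1..T. (norm (D (Suc t)))\<^sup>2 / \<beta> (Suc t)) = (\<Sum>t = 2..Suc T. (norm (D t))\<^sup>2 / \<beta> t)"
        using sum.shift_bounds_cl_Suc_ivl[of "\<lambda>t. (norm (D t))\<^sup>2 / \<beta> t" 1 T]
        by (simp add: numeral_2_eq_2)
      also have "\<dots> \<le> (\<Sum>t = 1..Suc T. (norm (D t))\<^sup>2 / \<beta> t)"
        using beta_pos by (intro sum_mono2) (auto intro!: divide_nonneg_pos)
      also have "\<dots> \<le> E"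
        by (rule E(1))
      finally have "(\<Sum>t = 1..T. (norm (D (Suc t)))\<^sup>2 / \<beta> (Suc t)) \<le> E" .
      moreover have "\<beta> (Suc t) \<le> 4 * \<beta>0 * real T powr p" if "t \<in> {1..T}" for t
        using beta_Suc_le[of t] beta_upper[of t] that by simp
      ultimately show "(\<Sum>t = 1..T. norm (D (Suc t))) \<le> (E + 4 * \<beta>0) / 2 * real T powr ((1 + p) / 2)"
        by (intro sum_le_of_weighted_squares[OF T]) (auto simp: beta_pos)
    qed
    also have "\<dots> = C1 * real T powr ((1 + p) / 2) + C2 * real T powr (1 - p)"
      by (simp add: C1_def algebra_simps)
    finally have "(\<Sum>t = 1..T. Crit f g h A (X (t + 1)) (yb (t + 1)) (z (t + 1)))
        \<le> C1 * real T powr ((1 + p) / 2) + C2 * real T powr (1 - p)" .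
    then have "1 / real T * (\<Sum>t = 1..T. Crit f g h A (X (t + 1)) (yb (t + 1)) (z (t + 1)))
        \<le> 1 / real T * (C1 * real T powr ((1 + p) / 2) + C2 * real T powr (1 - p))"
      by (intro mult_left_mono) auto
    also have "\<dots> = C1 * real T powr ((p - 1) / 2) + C2 * real T powr (- p)"
    proof -
      have shift: "1 / real T * real T powr e = real T powr (e - 1)" for e
        using T by (simp add: powr_diff)
      have "(1 + p) / 2 - 1 = (p - 1) / 2" "1 - p - 1 = - p"
        by (simp_all add: field_simps)
      then show ?thesis
        using shift[of "(1 + p) / 2"] shift[of "1 - p"] by (simp add: distrib_left mult.left_commute)
    qed
    finally show ?thesis .
  qed
  then show ?thesis
    using C by blast
qed

end

text \<open>An average of size \<open>C * T powr (- 1 / 3)\<close> must contain a term of that size.\<close>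

lemma exists_small_term_of_average:
  fixes c :: "nat \<Rightarrow> real"
  assumes C: "C \<ge> 0"
    and avg: "\<And>T. 1 \<le> T \<Longrightarrow> 1 / real T * (\<Sum>t = 1..T. c t) \<le> C * real T powr (- 1 / 3)"
    and e: "\<epsilon> > 0" and T: "1 \<le> T" "real T \<ge> (C + 1) ^ 3 / \<epsilon> ^ 3"
  shows "\<exists>t\<in>{1..T}. c t \<le> \<epsilon>"
proof (rule ccontr)
  assume "\<not> ?thesis"
  then have "\<epsilon> < c t" if "t \<in> {1..T}" for t
    using that by force
  then have "(\<Sum>t = 1..T. \<epsilon>) \<le> (\<Sum>t = 1..T. c t)"
    by (intro sum_mono less_imp_le)
  then have "\<epsilon> \<le> 1 / real T * (\<Sum>t = 1..T. c t)"
    using T(1) by (simp add: field_simps)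
  also have "\<dots> \<le> C * real T powr (- 1 / 3)"
    using avg T(1) .
  finally have small: "\<epsilon> \<le> C * real T powr (- 1 / 3)" .
  define x where "x = real T powr (1 / 3)"
  have x: "x > 0"
    using T(1) by (simp add: x_def)
  have "real T = x ^ 3"
    using T(1) by (simp add: x_def powr_realpow[symmetric] powr_powr)
  then have "((C + 1) / \<epsilon>) ^ 3 \<le> x ^ 3"
    using T(2) by (simp add: power_divide)
  then have "(C + 1) / \<epsilon> \<le> x"
    using power_le_imp_le_base[of "(C + 1) / \<epsilon>" 2 x] x by simp
  then have "C + 1 \<le> \<epsilon> * x"
    using e by (simp add: pos_divide_le_eq mult.commute)
  moreover have "\<epsilon> * x \<le> C"
  proof -
    have "real T powr (- 1 / 3) = 1 / x"
      using powr_minus_divide[of "real T" "1 / 3"] by (simp add: x_def)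
    then show ?thesis
      using small x by (simp add: pos_le_divide_eq)
  qed
  ultimately show False
    by linarith
qed

theorem theorem4p13:
  fixes f g :: "real ^ 'r ^ 'n \<Rightarrow> real"
    and h :: "real ^ 'm \<Rightarrow> real"
    and A :: "real ^ 'r ^ 'n \<Rightarrow> real ^ 'm"
    and Retr :: "real ^ 'r ^ 'n \<Rightarrow> real ^ 'r ^ 'n \<Rightarrow> real ^ 'r ^ 'n"
    and X :: "nat \<Rightarrow> real ^ 'r ^ 'n"
    and y yb z :: "nat \<Rightarrow> real ^ 'm"
    and L_f C_f C_g C_h W_h k1 k2 :: real
    and p \<xi> \<sigma> \<tau> \<beta>0 \<rho> \<gamma> \<delta> b_lo b_hi :: real
  assumes dims: "CARD('r) \<le> CARD('n)"
    and A_linear: "linear A"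
    and f_diff: "\<And>U. f differentiable (at U)"
    and f_smooth: "L_f-lipschitz_on UNIV (grad f)"
    and f_grad_bound: "\<And>U. U \<in> stiefel \<Longrightarrow> norm (grad f U) \<le> C_f"
    and g_convex: "convex_on UNIV g"
    and g_lipschitz: "C_g-lipschitz_on UNIV g"
    and h_lipschitz: "C_h-lipschitz_on UNIV h"
    and W_h_nonneg: "W_h \<ge> 0"
    and h_weakly_convex: "weakly_convex W_h h"
    and retraction: "retraction_with_consts Retr k1 k2"
    and p: "p = 1/3"
    and xi: "0 < \<xi>" "\<xi> < 1"
    and sigma: "1 \<le> \<sigma>" "\<sigma> < 2"
    and tau: "\<tau> \<ge> 4 / (2 - \<sigma>)"
    and beta0: "\<beta>0 > 0" "\<beta>0 \<ge> 2 * \<tau> * W_h"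
    and rho: "\<rho> > 0"
    and gamma: "0 < \<gamma>" "\<gamma> < 1"
    and delta: "0 < \<delta>" "\<delta> < 1 / max 1 (2 * \<rho>)"
    and b_bounds: "0 < b_lo" "0 < b_hi"
    and run: "oadmm_rr f g h A Retr p \<xi> \<sigma> \<tau> \<beta>0 \<rho> \<gamma> \<delta> b_lo b_hi X y yb z"
  shows
    "(\<exists>C1 C2. \<forall>T\<ge>1.
        1 / real T * (\<Sum>t = 1..T. Crit f g h A (X (t + 1)) (yb (t + 1)) (z (t + 1)))
          \<le> C1 * real T powr ((p - 1) / 2) + C2 * real T powr (- p)) \<and>
     (\<exists>C. \<forall>T\<ge>1.
        1 / real T * (\<Sum>t = 1..T. Crit f g h A (X (t + 1)) (yb (t + 1)) (z (t + 1)))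
          \<le> C * real T powr (- 1 / 3)) \<and>
     (\<exists>C' > 0. \<forall>\<epsilon> > 0. \<forall>T\<ge>1. real T \<ge> C' / \<epsilon> ^ 3 \<longrightarrow>
        (\<exists>t\<in>{1..T}. Crit f g h A (X (t + 1)) (yb (t + 1)) (z (t + 1)) \<le> \<epsilon>))"
proof -
  from run obtain G b j where
    X_0: "X 0 \<in> stiefel" and
    main: "\<And>t. let \<beta> = beta_seq \<beta>0 \<xi> p t;
            \<mu> = \<tau> / \<beta>;
            Ldot = (\<lambda>U. L_fun f g h A \<tau> U (y t) (z t) \<beta>);
            D = G_rho \<rho> (X t) (G t);
            step = (\<lambda>i. b t * \<gamma> ^ i / \<beta>);
            c = y t - (1 / \<beta>) *\<^sub>R grad (\<lambda>w. S_fun f A (X (Suc t)) w (z t) \<beta>) (y t)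
        in
          (\<exists>v\<in>limiting_subdiff g (X t).
             G t = grad (\<lambda>U. S_fun f A U (y t) (z t) \<beta>) (X t) - v) \<and>
          b_lo < b t \<and> b t < b_hi \<and>
          armijo Ldot Retr \<delta> (X t) D (step (j t)) \<and>
          (\<forall>i < j t. \<not> armijo Ldot Retr \<delta> (X t) D (step i)) \<and>
          X (Suc t) = Retr (X t) (- step (j t) *\<^sub>R D) \<and>
          is_arg_min (\<lambda>w. moreau_env h \<mu> w + \<beta> / 2 * (norm (w - c))\<^sup>2) (\<lambda>_. True) (y (Suc t)) \<and>
          is_arg_min (\<lambda>v. h v + 1 / (2 * (\<mu> + 1 / \<beta>)) * (norm (v - c))\<^sup>2) (\<lambda>_. True) (yb (Suc t)) \<and>
          z (Suc t) = z t + (\<sigma> * \<beta>) *\<^sub>R (A (X (Suc t)) - y (Suc t))"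
    unfolding oadmm_rr_def by blast
  \<comment> \<open>The subgradient of \<open>g\<close> entering \<open>G\<close>, recovered from \<open>G\<close> itself.\<close>
  define V where "V t = grad (\<lambda>U. S_fun f A U (y t) (z t) (beta_seq \<beta>0 \<xi> p t)) (X t) - G t" for t
  interpret oadmm_setting f g h A Retr L_f C_f C_g C_h W_h k1 k2 p \<xi> \<sigma> \<tau> \<beta>0 \<rho> \<gamma> \<delta> b_lo b_hi
      X y yb z V b j
    by (rule oadmm_setting.intro) (use assms in auto)
  have G_eq: "oadmm_setting.G f A p \<xi> \<beta>0 X y z V t = G t" for t
    by (simp add: G_def V_def \<beta>_def)
  have facts: "V t \<in> limiting_subdiff g (X t) \<and> b_lo < b t \<and>
      armijo (Ldot t) Retr \<delta> (X t) (D t) (step t (j t)) \<and>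
      (\<forall>i < j t. \<not> armijo (Ldot t) Retr \<delta> (X t) (D t) (step t i)) \<and>
      X (Suc t) = Retr (X t) (- step t (j t) *\<^sub>R D t) \<and>
      is_arg_min (\<lambda>w. moreau_env h (\<tau> / \<beta> t) w + \<beta> t / 2 * (norm (w - center t))\<^sup>2) (\<lambda>_. True)
        (y (Suc t)) \<and>
      is_arg_min (\<lambda>v. h v + 1 / (2 * (\<tau> / \<beta> t + 1 / \<beta> t)) * (norm (v - center t))\<^sup>2) (\<lambda>_. True)
        (yb (Suc t)) \<and>
      z (Suc t) = z t + (\<sigma> * \<beta> t) *\<^sub>R (A (X (Suc t)) - y (Suc t))" for t
  proof -
    have "V t \<in> limiting_subdiff g (X t)"
      using main[of t] by (auto simp: Let_def V_def)
    with main[of t] show ?thesis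
      unfolding Let_def Ldot_def[abs_def] D_def G_eq step_def center_def \<beta>_def by blast
  qed
  interpret oadmm_run f g h A Retr L_f C_f C_g C_h W_h k1 k2 p \<xi> \<sigma> \<tau> \<beta>0 \<rho> \<gamma> \<delta> b_lo b_hi
      X y yb z V b j
    by unfold_locales (use X_0 facts in blast)+
  obtain C1 C2 where C: "C1 \<ge> 0" "C2 \<ge> 0" and avg: "\<And>T. T \<ge> 1 \<Longrightarrow>
      1 / real T * (\<Sum>t = 1..T. Crit f g h A (X (t + 1)) (yb (t + 1)) (z (t + 1)))
        \<le> C1 * real T powr ((p - 1) / 2) + C2 * real T powr (- p)"
    using average_Crit_le by blast
  have avg': "1 / real T * (\<Sum>t = 1..T. Crit f g h A (X (t + 1)) (yb (t + 1)) (z (t + 1)))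
      \<le> (C1 + C2) * real T powr (- 1 / 3)" if "T \<ge> 1" for T
    using avg[OF that] unfolding \<open>p = 1 / 3\<close> by (simp add: distrib_right)
  have "\<exists>t\<in>{1..T}. Crit f g h A (X (t + 1)) (yb (t + 1)) (z (t + 1)) \<le> \<epsilon>"
    if "\<epsilon> > 0" "T \<ge> 1" "real T \<ge> (C1 + C2 + 1) ^ 3 / \<epsilon> ^ 3" for \<epsilon> T
    using exists_small_term_of_average[of "C1 + C2"
        "\<lambda>t. Crit f g h A (X (t + 1)) (yb (t + 1)) (z (t + 1))" \<epsilon> T] avg' C that by simp
  moreover have "(C1 + C2 + 1) ^ 3 > 0"
    using C by simp
  ultimately show ?thesis
    using avg avg' by blast
qed

end
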